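(* A sequence $\sigma$ of order $3$ with terms from $\{\mathtt{A^*},\mathtt{A^+},\mathtt{A^-},\mathtt{N},\mathtt{S^*},\mathtt{S^+},\mathtt{S^-}\}$ does not occur as a subsequence of the sepr-sequence of any Hermitian matrix if and only if one of the following statements holds: 1. $\sigma \in \{\mathtt{A^+XA^+},\mathtt{A^-XA^-},\mathtt{S^+XA^+},\mathtt{S^-XA^-}\}$ for some $\mathtt{X} \in \{\mathtt{A^*},\mathtt{N},\mathtt{S^*},\mathtt{S^+},\mathtt{S^-}\}$. 2. $\sigma \in \{\mathtt{A^+YS^+},\mathtt{A^-YS^-},\mathtt{S^+YS^+},\mathtt{S^-YS^-}\}$ for some $\mathtt{Y} \in \{\mathtt{A^*},\mathtt{N},\mathtt{S^*}\}$. 3. $\mathtt{A^*N}$ or $\mathtt{NA^*}$ or $\mathtt{S^*N}$ or $\mathtt{NS^*}$ is a subsequence of $\sigma$. 4. $\operatorname{uepr}(\sigma) \in \{\mathtt{NNA},\mathtt{NNS},\mathtt{NSA}\}$.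
   Context: Let $B \in \mathbb{C}^{n\times n}$ be Hermitian ($n$ any positive integer). For $\alpha\subseteq\{1,\dots,n\}$ with $|\alpha|=k\ge 1$, the determinant of the submatrix $B[\alpha]$ lying in the rows and columns indexed by $\alpha$ is a principal minor of order $k$ (it is a real number). The signed enhanced principal rank characteristic sequence (sepr-sequence) of $B$ is $\operatorname{sepr}(B)=t_1t_2\cdots t_n$, where each $t_k$ is one of the seven symbols $\mathtt{A^*},\mathtt{A^+},\mathtt{A^-},\mathtt{N},\mathtt{S^*},\mathtt{S^+},\mathtt{S^-}$, determined as follows: - $t_k=\mathtt{A^*}$ if all order-$k$ principal minors of $B$ are nonzero and there are both positive and negative ones; - $t_k=\mathtt{A^+}$ (respectively $\mathtt{A^-}$) if all order-$k$ principal minors of $B$ are positive (respectively negative); - $t_k=\mathtt{N}$ if all order-$k$ principal minors of $B$ are zero; - $t_k=\mathtt{S^*}$ if $B$ has a positive, a negative and a zero order-$k$ principal minor; - $t_k=\mathtt{S^+}$ (respectively $\mathtt{S^-}$) if $B$ has both a zero and a nonzero order-$k$ principal minor and all nonzero order-$k$ principal minors are positive (respectively negative). The order of a sequence is its number of terms. A subsequence of $x_1x_2\cdots x_n$ means a block of consecutive terms $x_px_{p+1}\cdots x_q$ with $1\le p\le q\le n$. For a sequence $\sigma$ in the seven symbols, $\operatorname{uepr}(\sigma)$ is the sequence in $\{\mathtt{A},\mathtt{N},\mathtt{S}\}$ obtained by removing the superscripts (if any) from all terms of $\sigma$; e.g. $\operatorname{uepr}(\mathtt{A^+NS^-S^*})=\mathtt{ANSS}$.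 *)

theory Defs
  imports
    "Jordan_Normal_Form.Schur_Decomposition"
    "Jordan_Normal_Form.DL_Submatrix"
    "HOL-Library.Sublist"
begin

definition hermitian_mat :: "complex mat \<Rightarrow> bool" where
  "hermitian_mat B \<longleftrightarrow> square_mat B \<and> mat_adjoint B = B"

(* Rows and columns are numbered 0, ..., n - 1.  The minors of a Hermitian matrix are
   real numbers (principal_minor_real below), so taking the real part loses nothing. *)
definition principal_minors :: "complex mat \<Rightarrow> nat \<Rightarrow> real set" where
  "principal_minors B k =
     {Re (det (submatrix B \<alpha> \<alpha>)) | \<alpha>. \<alpha> \<subseteq> {..<dim_row B} \<and> card \<alpha> = k}"

datatype sepr_sym = Astar | Aplus | Aminus | Nsym | Sstar | Splus | Sminus

(* M is the set of all principal minors of one fixed order. *)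
primrec sepr_cond :: "real set \<Rightarrow> sepr_sym \<Rightarrow> bool" where
  "sepr_cond M Astar \<longleftrightarrow> (\<forall>x\<in>M. x \<noteq> 0) \<and> (\<exists>x\<in>M. x > 0) \<and> (\<exists>x\<in>M. x < 0)"
| "sepr_cond M Aplus \<longleftrightarrow> (\<forall>x\<in>M. x > 0)"
| "sepr_cond M Aminus \<longleftrightarrow> (\<forall>x\<in>M. x < 0)"
| "sepr_cond M Nsym \<longleftrightarrow> (\<forall>x\<in>M. x = 0)"
| "sepr_cond M Sstar \<longleftrightarrow> (\<exists>x\<in>M. x > 0) \<and> (\<exists>x\<in>M. x < 0) \<and> (\<exists>x\<in>M. x = 0)"
| "sepr_cond M Splus \<longleftrightarrow>
     (\<exists>x\<in>M. x = 0) \<and> (\<exists>x\<in>M. x \<noteq> 0) \<and> (\<forall>x\<in>M. x \<noteq> 0 \<longrightarrow> x > 0)"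
| "sepr_cond M Sminus \<longleftrightarrow>
     (\<exists>x\<in>M. x = 0) \<and> (\<exists>x\<in>M. x \<noteq> 0) \<and> (\<forall>x\<in>M. x \<noteq> 0 \<longrightarrow> x < 0)"

(* The description operator is well defined for 1 <= k <= n: see sepr_term_unique. *)
definition sepr_term :: "complex mat \<Rightarrow> nat \<Rightarrow> sepr_sym" where
  "sepr_term B k = (THE t. sepr_cond (principal_minors B k) t)"

definition sepr :: "complex mat \<Rightarrow> sepr_sym list" where
  "sepr B = map (sepr_term B) [1..<Suc (dim_row B)]"

datatype uepr_sym = UeprA | UeprN | UeprS

primrec strip_sign :: "sepr_sym \<Rightarrow> uepr_sym" where
  "strip_sign Astar = UeprA"
| "strip_sign Aplus = UeprA"
| "strip_sign Aminus = UeprA"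
| "strip_sign Nsym = UeprN"
| "strip_sign Sstar = UeprS"
| "strip_sign Splus = UeprS"
| "strip_sign Sminus = UeprS"

definition uepr :: "sepr_sym list \<Rightarrow> uepr_sym list" where
  "uepr \<sigma> = map strip_sign \<sigma>"


lemma hermitian_mat_index:
  assumes "hermitian_mat B" "i < dim_row B" "j < dim_row B"
  shows "B $$ (i, j) = cnj (B $$ (j, i))"
proof -
  have sq: "dim_col B = dim_row B" and adj: "mat_adjoint B = B"
    using assms(1) by (auto simp: hermitian_mat_def)
  have "mat_adjoint B $$ (i, j) = cnj (B $$ (j, i))"
    unfolding mat_adjoint_def using assms(2,3) sq
    by (simp add: mat_of_rows_def)
  with adj show ?thesis by simp
qed

lemma principal_minor_real:
  assumes "hermitian_mat B" "\<alpha> \<subseteq> {..<dim_row B}"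
  shows "det (submatrix B \<alpha> \<alpha>) \<in> \<real>"
proof -
  define C where "C = submatrix B \<alpha> \<alpha>"
  define m where "m = card {i. i < dim_row B \<and> i \<in> \<alpha>}"
  have sq: "dim_col B = dim_row B" using assms(1) by (auto simp: hermitian_mat_def)
  have C: "C \<in> carrier_mat m m"
    unfolding C_def m_def submatrix_def by (auto simp: sq)
  have idx: "C $$ (i, j) = cnj (C $$ (j, i))" if "i < m" "j < m" for i j
  proof -
    have "pick \<alpha> i < dim_row B" "pick \<alpha> j < dim_row B"
      using that pick_le unfolding m_def by auto
    then have "B $$ (pick \<alpha> i, pick \<alpha> j) = cnj (B $$ (pick \<alpha> j, pick \<alpha> i))"
      by (rule hermitian_mat_index[OF assms(1)])
    moreover have "C $$ (a, b) = B $$ (pick \<alpha> a, pick \<alpha> b)" if "a < m" "b < m" for a b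
      using that unfolding C_def m_def by (simp add: submatrix_index sq)
    ultimately show ?thesis using that by metis
  qed
  interpret cnj: comm_ring_hom cnj by standard auto
  have "map_mat cnj C = transpose_mat C"
  proof (rule eq_matI)
    fix i j assume "i < dim_row (transpose_mat C)" "j < dim_col (transpose_mat C)"
    then have ij: "i < m" "j < m" using C by auto
    show "map_mat cnj C $$ (i, j) = transpose_mat C $$ (i, j)"
      using idx[OF ij(2) ij(1)] ij C by auto
  qed (use C in auto)
  then have "cnj (det C) = det C"
    using cnj.hom_det[of C] det_transpose[OF C] by simp
  then show ?thesis by (simp add: C_def Reals_cnj_iff)
qed

lemma sepr_cond_unique:
  assumes "M \<noteq> {}"
  shows "\<exists>!t. sepr_cond M t"
proof -
  define p n z where "p \<longleftrightarrow> (\<exists>x\<in>M. x > 0)" and "n \<longleftrightarrow> (\<exists>x\<in>M. x < 0)"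
    and "z \<longleftrightarrow> (\<exists>x\<in>M. x = 0)"
  note pnz = p_def n_def z_def
  have ne: "p \<or> n \<or> z"
    using assms unfolding pnz by (metis ex_in_conv linorder_neqE_linordered_idom)
  have 1: "(\<forall>x\<in>M. x \<noteq> 0) \<longleftrightarrow> \<not> z" unfolding pnz by blast
  have 2: "(\<forall>x\<in>M. x > 0) \<longleftrightarrow> \<not> n \<and> \<not> z"
    unfolding pnz by (metis less_asym less_irrefl linorder_neqE_linordered_idom)
  have 3: "(\<forall>x\<in>M. x < 0) \<longleftrightarrow> \<not> p \<and> \<not> z"
    unfolding pnz by (metis less_asym less_irrefl linorder_neqE_linordered_idom)
  have 4: "(\<forall>x\<in>M. x = 0) \<longleftrightarrow> \<not> p \<and> \<not> n"
    unfolding pnz by (metis less_irrefl linorder_neqE_linordered_idom)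
  have 5: "(\<exists>x\<in>M. x \<noteq> 0) \<longleftrightarrow> p \<or> n"
    using 4 by blast
  have 6: "(\<forall>x\<in>M. x \<noteq> 0 \<longrightarrow> x > 0) \<longleftrightarrow> \<not> n"
    unfolding pnz by (metis less_asym less_irrefl linorder_neqE_linordered_idom)
  have 7: "(\<forall>x\<in>M. x \<noteq> 0 \<longrightarrow> x < 0) \<longleftrightarrow> \<not> p"
    unfolding pnz by (metis less_asym less_irrefl linorder_neqE_linordered_idom)
  have cond: "sepr_cond M t = (case t of
      Astar \<Rightarrow> p \<and> n \<and> \<not> z | Aplus \<Rightarrow> \<not> n \<and> \<not> z | Aminus \<Rightarrow> \<not> p \<and> \<not> z
    | Nsym \<Rightarrow> \<not> p \<and> \<not> n | Sstar \<Rightarrow> p \<and> n \<and> z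
    | Splus \<Rightarrow> z \<and> (p \<or> n) \<and> \<not> n | Sminus \<Rightarrow> z \<and> (p \<or> n) \<and> \<not> p)" for t
    by (cases t) (simp_all only: sepr_cond.simps sepr_sym.case 1 2 3 4 5 6 7 flip: pnz, blast)
  show ?thesis
  proof (rule ex_ex1I)
    show "\<exists>t. sepr_cond M t"
      using ne unfolding cond by (cases p; cases n; cases z) (auto intro: exI[of _ Astar] exI[of _ Aplus]
        exI[of _ Aminus] exI[of _ Nsym] exI[of _ Sstar] exI[of _ Splus] exI[of _ Sminus])
  next
    fix s t assume "sepr_cond M s" "sepr_cond M t"
    then show "s = t"
      using ne unfolding cond by (cases s; cases t; simp; blast)
  qed
qed

lemma sepr_term_unique:
  assumes "k \<le> dim_row B"
  shows "\<exists>!t. sepr_cond (principal_minors B k) t"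
proof (rule sepr_cond_unique)
  have "{..<k} \<subseteq> {..<dim_row B} \<and> card {..<k} = k" using assms by auto
  then show "principal_minors B k \<noteq> {}" unfolding principal_minors_def by blast
qed

end

theory Submission
  imports Defs
begin

text \<open>
  Let \<open>B\<close> be Hermitian and let \<open>x\<close> be a vector of positive weights.  Expanding a determinant along
  its diagonal gives \<open>det (diag x + s B) = (\<Sum>k. f\<^sub>k(x) s^k)\<close>, where \<open>f\<^sub>k(x)\<close> (\<open>minor_sum\<close> below) is
  the sum of all principal minors of order \<open>k\<close>, each with a positive coefficient that is a monomial
  in \<open>x\<close>.  For every \<open>x\<close> this polynomial in \<open>s\<close> has only real roots, because a kernel vector \<open>v\<close>
  satisfies \<open>v\<^sup>* (diag x) v = - s (v\<^sup>* B v)\<close> with both quadratic forms real and the left one positive.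
  Derivatives of real-rooted polynomials are real-rooted, and the logarithmic derivative of a
  real-rooted polynomial is decreasing.  Hence a vanishing coefficient lies between coefficients
  whose product is at most zero, and two consecutive vanishing coefficients force all later
  ones to vanish.

  The link between signs of minors and zeros of coefficients is continuity: if some minors of
  order \<open>k\<close> are positive and others negative, then \<open>f\<^sub>k\<close> takes both signs on the positive orthant, so it
  has a zero \<open>x\<close> there.  Each exclusion now has a short reason.

  \<^item> If the minors of orders \<open>k\<close> and \<open>k + 2\<close> are all of one weak sign, and not all zero, then \<open>f\<^sub>k\<close> and
    \<open>f\<^bsub>k+2\<^esub>\<close> have this strict sign everywhere, so \<open>f\<^bsub>k+1\<^esub>\<close> never vanishes.  The symbol between them is
    therefore none of \<open>A\<^sup>*\<close>, \<open>N\<close>, \<open>S\<^sup>*\<close>  (\<open>same_signs_two_apart\<close>).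

  \<^item> If one of two consecutive orders is \<open>N\<close> and the other is \<open>N\<close>, \<open>A\<^sup>*\<close> or \<open>S\<^sup>*\<close>, then both coefficients
    vanish at a common \<open>x\<close>, so at this \<open>x\<close> all later coefficients vanish.  The number of nonzero
    coefficients is governed by the rank of \<open>B\<close> and not by \<open>x\<close>: at the largest order with
    a nonzero minor all nonzero minors share their sign, so that the coefficient of this order has no
    zero.  Thus all minors from there on vanish  (\<open>common_zero_imp_minors_vanish\<close>).

  \<^item> If a nonsingular principal submatrix has a zero principal minor of codimension one, it has a
    principal minor of codimension two of the sign opposite to its determinant
    (\<open>singular_codimension_one_minor\<close>).  This rules out a zero minor just below an order whose minors
    are all nonzero, unless the order two below contains a minor of the opposite sign.

  Conversely, a list of integer and Gaussian integer matrices of order at most six realizes all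
  other triples.  Passing to \<open>- B\<close> flips the signs in the odd orders, which shortens the list.  The
  minors are computed by Laplace expansion on integer lists.
\<close>

section \<open>Determinants over index sets\<close>

text \<open>
  The determinant of the principal submatrix with index set \<open>S\<close>, written with permutations of \<open>S\<close>
  itself.  No renumbering of rows takes place, so that minors for different index sets of one matrix
  can be compared directly.
\<close>

definition pdet :: "('i \<Rightarrow> 'i \<Rightarrow> 'a::comm_ring_1) \<Rightarrow> 'i set \<Rightarrow> 'a" where
  "pdet B S = (\<Sum>p | p permutes S. of_int (sign p) * (\<Prod>i\<in>S. B i (p i)))"

lemma pdet_cong:
  assumes "\<And>i j. i \<in> S \<Longrightarrow> j \<in> S \<Longrightarrow> A i j = B i j"
  shows "pdet A S = pdet B S"
  unfolding pdet_def
  by (intro sum.cong arg_cong2[where f = times] prod.cong refl assms) (auto simp: permutes_in_image)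

lemma pdet_reindex:
  assumes h: "bij_betw h S T" and S: "finite S"
  shows "pdet B T = pdet (\<lambda>i j. B (h i) (h j)) S"
proof -
  have inj: "inj_on h S" and img: "h ` S = T" using h by (auto simp: bij_betw_def)
  have g: "map_permutation S h = (\<lambda>p x. if x \<in> T then h (p (inv_into S h x)) else x)"
    by (auto simp: map_permutation_def restrict_id_def img fun_eq_iff)
  have bij: "bij_betw (map_permutation S h) {p. p permutes S} {p. p permutes T}"
    unfolding g by (rule bij_betw_permutations[OF h])
  have "pdet B T = (\<Sum>p | p permutes S. of_int (sign (map_permutation S h p)) *
      (\<Prod>i\<in>T. B i (map_permutation S h p i)))"
    unfolding pdet_def by (rule sum.reindex_bij_betw[OF bij, symmetric])
  also have "\<dots> = pdet (\<lambda>i j. B (h i) (h j)) S"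
    unfolding pdet_def
  proof (rule sum.cong[OF refl])
    fix p assume "p \<in> {p. p permutes S}"
    then have p: "p permutes S" by simp
    have "(\<Prod>i\<in>T. B i (map_permutation S h p i)) = (\<Prod>i\<in>S. B (h i) (map_permutation S h p (h i)))"
      by (rule prod.reindex_bij_betw[OF h, symmetric])
    then show "of_int (sign (map_permutation S h p)) * (\<Prod>i\<in>T. B i (map_permutation S h p i)) =
        of_int (sign p) * (\<Prod>i\<in>S. B (h i) (h (p i)))"
      using inj p S by (simp add: sign_map_permutation map_permutation_apply cong: prod.cong)
  qed
  finally show ?thesis .
qed

lemma pdet_eq_det:
  assumes "bij_betw h {0..<n} S"
  shows "pdet B S = det (mat n n (\<lambda>(i, j). B (h i) (h j)))"
proof -
  have "pdet B S = pdet (\<lambda>i j. B (h i) (h j)) {0..<n}"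
    by (rule pdet_reindex[OF assms]) simp
  also have "\<dots> = det (mat n n (\<lambda>(i, j). B (h i) (h j)))"
    unfolding pdet_def det_def'[OF mat_carrier]
    by (intro sum.cong arg_cong2[where f = times] prod.cong refl) (auto simp: permutes_in_image)
  finally show ?thesis .
qed

lemma pdet_mult:
  fixes A C :: "'i \<Rightarrow> 'i \<Rightarrow> 'a::idom"
  assumes "finite S"
  shows "pdet (\<lambda>i j. \<Sum>k\<in>S. A i k * C k j) S = pdet A S * pdet C S"
proof -
  obtain h where h: "bij_betw h {0..<card S} S"
    using ex_bij_betw_nat_finite[OF assms] by blast
  let ?M = "\<lambda>B. mat (card S) (card S) (\<lambda>(i, j). B (h i) (h j))"
  have "?M (\<lambda>i j. \<Sum>k\<in>S. A i k * C k j) = ?M A * ?M C"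
    by (rule eq_matI) (auto simp: scalar_prod_def sum.reindex_bij_betw[OF h, symmetric])
  then show ?thesis
    unfolding pdet_eq_det[OF h] by (simp add: det_mult[of _ "card S"])
qed

lemma pdet_eq_0_iff:
  fixes B :: "'i \<Rightarrow> 'i \<Rightarrow> 'a::field"
  assumes "finite S"
  shows "pdet B S = 0 \<longleftrightarrow> (\<exists>v. (\<exists>i\<in>S. v i \<noteq> 0) \<and> (\<forall>i\<in>S. (\<Sum>j\<in>S. B i j * v j) = 0))"
proof -
  define n where "n = card S"
  obtain h where h: "bij_betw h {0..<n} S"
    unfolding n_def using ex_bij_betw_nat_finite[OF assms] by blast
  let ?M = "mat n n (\<lambda>(i, j). B (h i) (h j))"
  have sums: "(\<Sum>j\<in>S. B i j * v j) = (\<Sum>j = 0..<n. B i (h j) * v (h j))" for v i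
    by (rule sum.reindex_bij_betw[OF h, symmetric])
  have mem: "h i \<in> S" if "i < n" for i
    using h that by (auto simp: bij_betw_def)
  have ex: "\<exists>i<n. x = h i" if "x \<in> S" for x
    using h that by (force simp: bij_betw_def)
  have "pdet B S = 0 \<longleftrightarrow> (\<exists>w \<in> carrier_vec n. w \<noteq> 0\<^sub>v n \<and> ?M *\<^sub>v w = 0\<^sub>v n)"
    unfolding pdet_eq_det[OF h] by (subst det_0_iff_vec_prod_zero[of _ n]) auto
  also have "\<dots> \<longleftrightarrow> (\<exists>v. (\<exists>i\<in>S. v i \<noteq> 0) \<and> (\<forall>i\<in>S. (\<Sum>j\<in>S. B i j * v j) = 0))"
  proof
    assume "\<exists>w \<in> carrier_vec n. w \<noteq> 0\<^sub>v n \<and> ?M *\<^sub>v w = 0\<^sub>v n"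
    then obtain w where w: "w \<in> carrier_vec n" "w \<noteq> 0\<^sub>v n" "?M *\<^sub>v w = 0\<^sub>v n" by blast
    define v where "v x = w $ inv_into {0..<n} h x" for x
    have v: "v (h i) = w $ i" if "i < n" for i
      using that h by (simp add: v_def bij_betw_def)
    have nz: "\<exists>i\<in>S. v i \<noteq> 0"
    proof (rule ccontr)
      assume "\<not> ?thesis"
      then have "w $ i = 0" if "i < n" for i using v[OF that] mem[OF that] by auto
      then have "w = 0\<^sub>v n" using w(1) by (intro eq_vecI) auto
      with w(2) show False ..
    qed
    have "(\<Sum>j\<in>S. B x j * v j) = 0" if x: "x \<in> S" for x
    proof -
      obtain i where i: "i < n" "x = h i" using ex[OF x] by blast
      have "(?M *\<^sub>v w) $ i = 0" using w(3) i by simp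
      then show ?thesis using i w(1) v by (simp add: sums scalar_prod_def)
    qed
    with nz show "\<exists>v. (\<exists>i\<in>S. v i \<noteq> 0) \<and> (\<forall>i\<in>S. (\<Sum>j\<in>S. B i j * v j) = 0)" by blast
  next
    assume "\<exists>v. (\<exists>i\<in>S. v i \<noteq> 0) \<and> (\<forall>i\<in>S. (\<Sum>j\<in>S. B i j * v j) = 0)"
    then obtain v where v: "\<exists>i\<in>S. v i \<noteq> 0" "\<forall>i\<in>S. (\<Sum>j\<in>S. B i j * v j) = 0" by blast
    define w where "w = vec n (\<lambda>i. v (h i))"
    obtain i where "i < n" "v (h i) \<noteq> 0" using v(1) ex by metis
    then have "w \<noteq> 0\<^sub>v n" by (auto simp: w_def dest: arg_cong[where f = "\<lambda>u. u $ i"])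
    moreover have "?M *\<^sub>v w = 0\<^sub>v n"
      using v(2) mem by (intro eq_vecI) (auto simp: w_def scalar_prod_def sums)
    ultimately show "\<exists>w \<in> carrier_vec n. w \<noteq> 0\<^sub>v n \<and> ?M *\<^sub>v w = 0\<^sub>v n"
      by (intro bexI[of _ w]) (auto simp: w_def)
  qed
  finally show ?thesis .
qed

text \<open>
  Expand each product over the rows into the rows \<open>T\<close> that contribute an entry of \<open>B\<close> and the rows
  outside \<open>T\<close> that contribute a diagonal weight; the latter must be fixed by the permutation, which leaves
  exactly the permutations of \<open>T\<close>.
\<close>

lemma pdet_diagonal_pencil:
  fixes B :: "'i \<Rightarrow> 'i \<Rightarrow> 'a::comm_ring_1"
  assumes S: "finite S"
  shows "pdet (\<lambda>i j. s * B i j + (if i = j then x i else 0)) S =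
    (\<Sum>T\<in>Pow S. s ^ card T * pdet B T * (\<Prod>i\<in>S - T. x i))"
proof -
  let ?D = "\<lambda>p i. if i = p i then x i else 0"
  have fin: "finite T" if "T \<in> Pow S" for T using that S finite_subset by blast
  have "pdet (\<lambda>i j. s * B i j + (if i = j then x i else 0)) S =
      (\<Sum>p | p permutes S. \<Sum>T\<in>Pow S.
         of_int (sign p) * ((\<Prod>i\<in>T. s * B i (p i)) * (\<Prod>i\<in>S - T. ?D p i)))"
    unfolding pdet_def by (simp only: prod_add[OF S] sum_distrib_left)
  also have "\<dots> = (\<Sum>T\<in>Pow S. \<Sum>p | p permutes S.
         of_int (sign p) * ((\<Prod>i\<in>T. s * B i (p i)) * (\<Prod>i\<in>S - T. ?D p i)))"
    by (rule sum.swap)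
  also have "\<dots> = (\<Sum>T\<in>Pow S. s ^ card T * pdet B T * (\<Prod>i\<in>S - T. x i))"
  proof (rule sum.cong[OF refl])
    fix T assume T: "T \<in> Pow S"
    let ?f = "\<lambda>p. of_int (sign p) * ((\<Prod>i\<in>T. s * B i (p i)) * (\<Prod>i\<in>S - T. ?D p i))"
    have "(\<Sum>p | p permutes S. ?f p) = (\<Sum>p | p permutes T. ?f p)"
    proof (rule sum.mono_neutral_right)
      show "finite {p. p permutes S}" using S by (rule finite_permutations)
      show "{p. p permutes T} \<subseteq> {p. p permutes S}" using T permutes_subset by blast
      show "\<forall>p\<in>{p. p permutes S} - {p. p permutes T}. ?f p = 0"
      proof
        fix p assume p: "p \<in> {p. p permutes S} - {p. p permutes T}"
        then obtain i where "i \<in> S - T" "p i \<noteq> i"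
          using permutes_superset[of p S T] by blast
        then have "(\<Prod>i\<in>S - T. ?D p i) = 0"
          using S by (intro prod_zero) (auto intro!: bexI[of _ i])
        then show "?f p = 0" by simp
      qed
    qed
    also have "\<dots> = (\<Sum>p | p permutes T. s ^ card T * (of_int (sign p) * (\<Prod>i\<in>T. B i (p i))) * (\<Prod>i\<in>S - T. x i))"
    proof (rule sum.cong[OF refl])
      fix p assume "p \<in> {p. p permutes T}"
      then have "(\<Prod>i\<in>S - T. ?D p i) = (\<Prod>i\<in>S - T. x i)"
        by (intro prod.cong) (auto simp: permutes_not_in)
      then show "?f p = s ^ card T * (of_int (sign p) * (\<Prod>i\<in>T. B i (p i))) * (\<Prod>i\<in>S - T. x i)"
        using fin[OF T] by (simp add: prod.distrib prod_constant mult_ac)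
    qed
    finally show "(\<Sum>p | p permutes S. ?f p) = s ^ card T * pdet B T * (\<Prod>i\<in>S - T. x i)"
      by (simp add: pdet_def sum_distrib_left sum_distrib_right)
  qed
  finally show ?thesis .
qed

lemma bij_betw_pick: "finite \<alpha> \<Longrightarrow> bij_betw (pick \<alpha>) {0..<card \<alpha>} \<alpha>"
proof -
  assume f: "finite \<alpha>"
  have inj: "inj_on (pick \<alpha>) {0..<card \<alpha>}"
    by (rule strict_mono_on_imp_inj_on) (auto intro!: strict_mono_onI pick_mono_le)
  moreover have "pick \<alpha> ` {0..<card \<alpha>} = \<alpha>"
    using f by (intro card_subset_eq) (auto simp: card_image[OF inj] intro: pick_in_set_le)
  ultimately show ?thesis by (simp add: bij_betw_def)
qed

lemma det_submatrix_eq_pdet: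
  assumes "B \<in> carrier_mat n n" "\<alpha> \<subseteq> {..<n}"
  shows "det (submatrix B \<alpha> \<alpha>) = pdet (\<lambda>i j. B $$ (i, j)) \<alpha>"
proof -
  have f: "finite \<alpha>" using assms(2) finite_subset by blast
  have e: "{i. i < dim_row B \<and> i \<in> \<alpha>} = \<alpha>" "{i. i < dim_col B \<and> i \<in> \<alpha>} = \<alpha>" using assms by auto
  show ?thesis unfolding pdet_eq_det[OF bij_betw_pick[OF f]] submatrix_def e by simp
qed

lemma pdet_uminus:
  "finite S \<Longrightarrow> pdet (\<lambda>i j. - B i j) S = (- 1) ^ card S * pdet B S"
  unfolding pdet_def by (simp add: sum_distrib_left prod.distrib mult_ac flip: prod_uminus)

section \<open>Real-rooted polynomials\<close>

definition real_rooted :: "complex poly \<Rightarrow> bool" where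
  "real_rooted p \<longleftrightarrow> (\<forall>z. poly p z = 0 \<longrightarrow> z \<in> \<real>)"

lemma real_rooted_imp_nonzero: "real_rooted p \<Longrightarrow> p \<noteq> 0"
  unfolding real_rooted_def by (metis complex_is_Real_iff imaginary_unit.sel(2) one_neq_zero poly_0)

abbreviation lin_prod :: "real list \<Rightarrow> complex poly" where
  "lin_prod as \<equiv> \<Prod>a\<leftarrow>as. [:- complex_of_real a, 1:]"

lemma real_rooted_factorization:
  assumes "real_rooted p"
  obtains as :: "real list" where "p = smult (lead_coeff p) (lin_prod as)"
    "length as = degree p"
proof -
  obtain zs where zs: "smult (lead_coeff p) (\<Prod>a\<leftarrow>zs. [:- a, 1:]) = p" "length zs = degree p"
    using fundamental_theorem_algebra_factorized by blast
  have "z \<in> \<real>" if z: "z \<in> set zs" for z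
  proof -
    have "poly p z = 0"
      by (subst zs(1)[symmetric]) (use z in \<open>auto simp: poly_prod_list prod_list_zero_iff image_iff intro!: bexI[of _ z]\<close>)
    with assms show ?thesis by (auto simp: real_rooted_def)
  qed
  then have "map (\<lambda>a. [:- complex_of_real a, 1:]) (map Re zs) = map (\<lambda>z. [:- z, 1:]) zs"
    by (auto simp: of_real_Re)
  then show thesis
    using zs by (intro that[of "map Re zs"]) (simp_all only: length_map)
qed

lemma lin_prod_nonzero_off_real: "Im z \<noteq> 0 \<Longrightarrow> poly (lin_prod as) z \<noteq> 0"
  by (auto simp: poly_prod_list prod_list_zero_iff)

lemma pderiv_linear_mult:
  "pderiv ([:- c, 1:] * g) = g + [:- c, 1:] * pderiv (g :: 'a::idom poly)"
  unfolding pderiv_mult by (simp add: pderiv_pCons)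

text \<open>
  The imaginary part of \<open>q' / q = (\<Sum>a. 1 / (z - a))\<close> has the sign opposite to that of \<open>Im z\<close>, as every
  summand does.  Multiplying by \<open>\<bar>q\<bar>\<^sup>2\<close> avoids the division.
\<close>

lemma lin_prod_logarithmic_derivative:
  "Im z * Im (poly (pderiv (lin_prod as)) z * cnj (poly (lin_prod as) z)) \<le> 0 \<and>
   (as \<noteq> [] \<longrightarrow> Im z \<noteq> 0 \<longrightarrow>
    Im z * Im (poly (pderiv (lin_prod as)) z * cnj (poly (lin_prod as) z)) < 0)"
proof (induction as)
  case (Cons a as)
  let ?g = "poly (lin_prod as) z" and ?g' = "poly (pderiv (lin_prod as)) z"
  let ?w = "z - complex_of_real a"
  have "poly (pderiv (lin_prod (a # as))) z * cnj (poly (lin_prod (a # as)) z) =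
      (?g + ?w * ?g') * cnj (?w * ?g)"
    by (simp add: pderiv_linear_mult algebra_simps del: mult_pCons_left)
  also have "\<dots> = of_real ((cmod ?g)\<^sup>2) * cnj ?w + of_real ((cmod ?w)\<^sup>2) * (?g' * cnj ?g)"
    by (simp only: complex_norm_square) (simp add: algebra_simps)
  finally have eq: "poly (pderiv (lin_prod (a # as))) z * cnj (poly (lin_prod (a # as)) z) =
      of_real ((cmod ?g)\<^sup>2) * cnj ?w + of_real ((cmod ?w)\<^sup>2) * (?g' * cnj ?g)" .
  have Im_eq: "Im (of_real s * cnj ?w + of_real t * Y) = - s * Im z + t * Im Y" for s t Y
    by simp
  define K where "K = Im z * Im (?g' * cnj ?g)"
  have "Im z * Im (poly (pderiv (lin_prod (a # as))) z * cnj (poly (lin_prod (a # as)) z)) =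
      - ((Im z)\<^sup>2 * (cmod ?g)\<^sup>2) + (cmod ?w)\<^sup>2 * K"
    unfolding eq Im_eq K_def power2_eq_square by argo
  moreover have "(cmod ?w)\<^sup>2 * K \<le> 0"
    using conjunct1[OF Cons.IH] unfolding K_def by (rule mult_nonneg_nonpos[OF zero_le_power2])
  moreover have "(Im z)\<^sup>2 * (cmod ?g)\<^sup>2 > 0" if "Im z \<noteq> 0"
    using that lin_prod_nonzero_off_real[OF that] by (intro mult_pos_pos) auto
  moreover have "(Im z)\<^sup>2 * (cmod ?g)\<^sup>2 \<ge> 0" by simp
  ultimately show ?case by linarith
qed (auto simp: pderiv_1)

text \<open>
  The Gauss--Lucas argument for the real line: off the real line the logarithmic derivative has a
  nonzero imaginary part.
\<close>

lemma real_rooted_pderiv: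
  assumes p: "real_rooted p" and nz: "pderiv p \<noteq> 0"
  shows "real_rooted (pderiv p)"
  unfolding real_rooted_def
proof (intro allI impI)
  fix z assume z: "poly (pderiv p) z = 0"
  obtain as where as: "p = smult (lead_coeff p) (lin_prod as)" "length as = degree p"
    using real_rooted_factorization[OF p] .
  have lc: "lead_coeff p \<noteq> 0" using real_rooted_imp_nonzero[OF p] by simp
  have "as \<noteq> []" using as(2) nz pderiv_eq_0_iff[of p] by auto
  have "poly (pderiv (lin_prod as)) z = 0"
    using z lc by (subst (asm) as(1)) (simp add: pderiv_smult del: lead_coeff_prod)
  then show "z \<in> \<real>"
    using lin_prod_logarithmic_derivative[of z as] \<open>as \<noteq> []\<close> by (auto simp: complex_is_Real_iff)
qed

lemma real_rooted_higher_pderiv: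
  assumes "real_rooted p" "(pderiv ^^ k) p \<noteq> 0"
  shows "real_rooted ((pderiv ^^ k) p)"
  using assms(2)
proof (induction k)
  case (Suc k)
  then have "(pderiv ^^ k) p \<noteq> 0" by auto
  with Suc show ?case by (auto intro: real_rooted_pderiv)
qed (use assms in auto)

text \<open>
  The Laguerre inequality at the origin: \<open>q'' q - q'\<^sup>2 = q\<^sup>2 (q' / q)'\<close> is minus a sum of squares.  The
  number \<open>S\<close> records when it is strict, which is needed to see that two vanishing coefficients
  leave no room for a root.
\<close>

lemma lin_prod_laguerre:
  "\<exists>r S :: real. poly (lin_prod as) 0 = of_real r \<and> S \<ge> 0 \<and> (as \<noteq> [] \<longrightarrow> r \<noteq> 0 \<longrightarrow> S > 0) \<and>
     poly (pderiv (pderiv (lin_prod as))) 0 * poly (lin_prod as) 0 -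
     (poly (pderiv (lin_prod as)) 0)\<^sup>2 = - complex_of_real S"
proof (induction as)
  case Nil
  show ?case by (rule exI[of _ 1], rule exI[of _ 0]) (simp add: pderiv_1)
next
  case (Cons a as)
  then obtain r S where r: "poly (lin_prod as) 0 = of_real r" and S: "S \<ge> 0"
    and eq: "poly (pderiv (pderiv (lin_prod as))) 0 * poly (lin_prod as) 0 -
      (poly (pderiv (lin_prod as)) 0)\<^sup>2 = - complex_of_real S" by blast
  have "poly (lin_prod (a # as)) 0 = complex_of_real (- a * r)" using r by simp
  moreover have "poly (pderiv (pderiv (lin_prod (a # as)))) 0 * poly (lin_prod (a # as)) 0 -
      (poly (pderiv (lin_prod (a # as))) 0)\<^sup>2 =
      complex_of_real (a\<^sup>2) * (poly (pderiv (pderiv (lin_prod as))) 0 * poly (lin_prod as) 0 -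
      (poly (pderiv (lin_prod as)) 0)\<^sup>2) - (poly (lin_prod as) 0)\<^sup>2"
    by (simp add: pderiv_linear_mult pderiv_add algebra_simps power2_eq_square del: mult_pCons_left)
  then have "poly (pderiv (pderiv (lin_prod (a # as)))) 0 * poly (lin_prod (a # as)) 0 -
      (poly (pderiv (lin_prod (a # as))) 0)\<^sup>2 = - complex_of_real (a\<^sup>2 * S + r\<^sup>2)"
    unfolding eq unfolding r by simp
  moreover have "a\<^sup>2 * S + r\<^sup>2 > 0" if "- a * r \<noteq> 0"
    using that S by (intro add_nonneg_pos) auto
  ultimately show ?case using S
    by (intro exI[of _ "- a * r"] exI[of _ "a\<^sup>2 * S + r\<^sup>2"]) auto
qed

text \<open>
  Apply the Laguerre inequality to the \<open>k\<close>-th derivative, whose first three Taylor coefficients at the origin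
  are positive multiples of the coefficients \<open>k\<close>, \<open>k + 1\<close>, \<open>k + 2\<close>.  If \<open>t = 0\<close>, the derivative has no
  root at all and is therefore constant.
\<close>

lemma real_rooted_coeff_gap:
  assumes p: "real_rooted p" and nz: "coeff p k \<noteq> 0" and gap: "coeff p (Suc k) = 0"
  obtains t where "t \<ge> 0" "coeff p (k + 2) = - complex_of_real t * coeff p k"
    "t = 0 \<Longrightarrow> \<forall>j>k. coeff p j = 0"
proof -
  define q where "q = (pderiv ^^ k) p"
  have cq: "coeff q n = pochhammer (of_nat (Suc n)) k * coeff p (n + k)" for n
    unfolding q_def by (rule coeff_higher_pderiv)
  \<comment> \<open>the factor by which the \<open>k\<close>-th derivative scales the coefficient \<open>n + k\<close>\<close>
  define A where "A n = real (pochhammer (Suc n) k)" for n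
  have A: "A n > 0" for n unfolding A_def by (simp add: pochhammer_pos del: pochhammer_Suc)
  have fr: "pochhammer (of_nat (Suc n) :: complex) k = of_real (A n)" for n
    by (simp add: A_def pochhammer_of_nat del: of_nat_Suc)
  have poch: "pochhammer (of_nat (Suc n) :: complex) k \<noteq> 0" for n
    unfolding fr using A[of n] by simp
  have q0: "coeff q 0 \<noteq> 0" using nz poch[of 0] by (simp add: cq)
  then have "q \<noteq> 0" by auto
  then have rr: "real_rooted q" unfolding q_def by (rule real_rooted_higher_pderiv[OF p])
  obtain as where as: "q = smult (lead_coeff q) (lin_prod as)" "length as = degree q"
    using real_rooted_factorization[OF rr] .
  define c where "c = lead_coeff q"
  define g where "g = lin_prod as"
  have qg: "q = smult c g" using as(1) by (simp add: c_def g_def)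
  obtain r S where r: "poly g 0 = of_real r" and S: "S \<ge> 0" "as \<noteq> [] \<longrightarrow> r \<noteq> 0 \<longrightarrow> S > 0"
    and eq: "poly (pderiv (pderiv g)) 0 * poly g 0 - (poly (pderiv g) 0)\<^sup>2 = - complex_of_real S"
    unfolding g_def using lin_prod_laguerre by blast
  have c: "c \<noteq> 0" and r0: "r \<noteq> 0" using q0 r unfolding qg by (auto simp flip: poly_0_coeff_0)
  have "coeff q 1 = 0" using gap by (simp add: cq)
  then have "poly (pderiv g) 0 = 0" using c by (simp add: poly_0_coeff_0 coeff_pderiv qg)
  with eq r have eq': "poly (pderiv (pderiv g)) 0 * of_real r = - complex_of_real S" by simp
  have "2 * coeff q 2 = c * poly (pderiv (pderiv g)) 0"
    by (simp add: poly_0_coeff_0 coeff_pderiv qg numeral_2_eq_2)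
  moreover have "coeff q 0 = c * of_real r"
    using r by (simp add: qg flip: poly_0_coeff_0)
  ultimately have "2 * coeff q 2 * of_real (r\<^sup>2) = - of_real S * coeff q 0"
    using eq' by (simp add: power2_eq_square) (metis (no_types, lifting) mult.assoc mult.commute mult_minus_right)
  then have q2: "coeff q 2 = - of_real (S / (2 * r\<^sup>2)) * coeff q 0"
    using r0 by (simp add: field_simps)
  have cA: "coeff q n = of_real (A n) * coeff p (n + k)" for n unfolding cq A_def fr ..
  have A2: "complex_of_real (A 2) \<noteq> 0" and r0': "complex_of_real r \<noteq> 0"
    using A[of 2] r0 by auto
  show thesis
  proof (rule that[of "S / (2 * r\<^sup>2) * A 0 / A 2"])
    show "S / (2 * r\<^sup>2) * A 0 / A 2 \<ge> 0" using S A[of 0] A[of 2] by simp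
    have "of_real (A 2) * coeff p (k + 2) = - of_real (S / (2 * r\<^sup>2)) * (of_real (A 0) * coeff p k)"
      using q2 unfolding cA by (simp add: add.commute)
    then show "coeff p (k + 2) = - complex_of_real (S / (2 * r\<^sup>2) * A 0 / A 2) * coeff p k"
      using A2 r0' by (simp add: field_simps)
    assume "S / (2 * r\<^sup>2) * A 0 / A 2 = 0"
    then have "S = 0" using A[of 0] A[of 2] r0 by auto
    then have "as = []" using S r0 by auto
    show "\<forall>j>k. coeff p j = 0"
    proof (intro allI impI)
      fix j assume j: "j > k"
      have "coeff q (j - k) = 0" using \<open>as = []\<close> as(2) j by (intro coeff_eq_0) auto
      then show "coeff p j = 0" using A[of "j - k"] j by (simp add: cA)
    qed
  qed
qed

lemma real_rooted_newton_at_zero: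
  assumes p: "real_rooted p" and m: "coeff p m = of_real a" "coeff p (Suc m) = 0" "coeff p (m + 2) = of_real b"
  shows "a * b \<le> 0"
proof (cases "a = 0")
  case False
  with m(1) have "coeff p m \<noteq> 0" by simp
  then obtain t where "t \<ge> 0" and t: "coeff p (m + 2) = - complex_of_real t * coeff p m"
    using real_rooted_coeff_gap[OF p _ m(2)] by metis
  from t m have "b = - t * a" by (metis of_real_eq_iff of_real_minus of_real_mult)
  then have "a * b = - (t * a\<^sup>2)" by (simp add: power2_eq_square)
  then show ?thesis using \<open>t \<ge> 0\<close> by simp
qed simp

text \<open>
  Start from the last nonzero coefficient before the gap; it is followed by two zeros.
\<close>

lemma real_rooted_double_gap:
  assumes p: "real_rooted p" and "coeff p 0 \<noteq> 0" "coeff p m = 0" "coeff p (Suc m) = 0" and j: "j \<ge> m"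
  shows "coeff p j = 0"
proof -
  define k where "k = (GREATEST k. k < m \<and> coeff p k \<noteq> 0)"
  have "0 < m" using assms by (metis gr0I)
  have ex: "\<exists>k. k < m \<and> coeff p k \<noteq> 0" using assms \<open>0 < m\<close> by blast
  have k: "k < m" "coeff p k \<noteq> 0"
    unfolding k_def using GreatestI_ex_nat[OF ex, of m] by auto
  have between: "coeff p i = 0" if "k < i" "i < m" for i
    using that Greatest_le_nat[of "\<lambda>k. k < m \<and> coeff p k \<noteq> 0" i m] unfolding k_def by force
  have gap: "coeff p (Suc k) = 0" and gap2: "coeff p (k + 2) = 0"
  proof -
    show "coeff p (Suc k) = 0" using between[of "Suc k"] k assms(3) by (cases "Suc k = m") auto
    have "k + 2 < m \<or> k + 2 = m \<or> k + 2 = Suc m" using k by auto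
    then show "coeff p (k + 2) = 0" using between[of "k + 2"] assms(3,4) by auto
  qed
  obtain t where t: "coeff p (k + 2) = - complex_of_real t * coeff p k"
    "t = 0 \<Longrightarrow> \<forall>j>k. coeff p j = 0"
    using real_rooted_coeff_gap[OF p k(2) gap] by blast
  have "t = 0" using t(1) gap2 k(2) by simp
  then show ?thesis using t(2) k(1) j by simp
qed

section \<open>Weighted sums of the minors of a Hermitian matrix\<close>

lemma pdet_empty [simp]: "pdet B {} = 1"
  by (simp add: pdet_def)

lemma pdet_transpose:
  assumes "finite S"
  shows "pdet (\<lambda>i j. B j i) S = pdet B S"
proof -
  obtain h where h: "bij_betw h {0..<card S} S"
    using ex_bij_betw_nat_finite[OF assms] by blast
  have "mat (card S) (card S) (\<lambda>(i, j). B (h j) (h i)) =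
      transpose_mat (mat (card S) (card S) (\<lambda>(i, j). B (h i) (h j)))"
    by (rule eq_matI) auto
  then show ?thesis
    unfolding pdet_eq_det[OF h] by (simp add: det_transpose[of _ "card S"])
qed

lemma pdet_cnj: "pdet (\<lambda>i j. cnj (B i j)) S = cnj (pdet B S)"
  by (simp add: pdet_def)

definition herm_on :: "('i \<Rightarrow> 'i \<Rightarrow> complex) \<Rightarrow> 'i set \<Rightarrow> bool" where
  "herm_on B S \<longleftrightarrow> (\<forall>i\<in>S. \<forall>j\<in>S. B i j = cnj (B j i))"

lemma herm_onD: "herm_on B S \<Longrightarrow> i \<in> S \<Longrightarrow> j \<in> S \<Longrightarrow> B i j = cnj (B j i)"
  unfolding herm_on_def by blast

lemma herm_on_subset: "herm_on B S \<Longrightarrow> T \<subseteq> S \<Longrightarrow> herm_on B T"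
  unfolding herm_on_def by blast

lemma pdet_herm_on:
  assumes "finite S" "herm_on B S"
  shows "pdet B S = complex_of_real (Re (pdet B S))"
proof -
  have "pdet B S = pdet (\<lambda>i j. cnj (B j i)) S"
    by (rule pdet_cong) (rule herm_onD[OF assms(2)])
  also have "\<dots> = cnj (pdet B S)"
    unfolding pdet_transpose[OF assms(1), where B = "\<lambda>i j. cnj (B i j)"] by (rule pdet_cnj)
  finally show ?thesis by (simp add: complex_eq_iff)
qed

definition minor_sum :: "('i \<Rightarrow> 'i \<Rightarrow> complex) \<Rightarrow> 'i set \<Rightarrow> nat \<Rightarrow> ('i \<Rightarrow> real) \<Rightarrow> real" where
  "minor_sum B S k x = (\<Sum>T | T \<subseteq> S \<and> card T = k. Re (pdet B T) * (\<Prod>i\<in>S - T. x i))"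

definition pencil_poly :: "('i \<Rightarrow> 'i \<Rightarrow> complex) \<Rightarrow> 'i set \<Rightarrow> ('i \<Rightarrow> real) \<Rightarrow> complex poly" where
  "pencil_poly B S x = (\<Sum>T\<in>Pow S. monom (pdet B T * (\<Prod>i\<in>S - T. complex_of_real (x i))) (card T))"

lemma poly_pencil_poly:
  assumes "finite S"
  shows "poly (pencil_poly B S x) s =
    pdet (\<lambda>i j. s * B i j + (if i = j then complex_of_real (x i) else 0)) S"
  unfolding pdet_diagonal_pencil[OF assms] pencil_poly_def
  by (simp add: poly_sum poly_monom mult_ac)

lemma coeff_pencil_poly:
  assumes "finite S" "herm_on B S"
  shows "coeff (pencil_poly B S x) k = complex_of_real (minor_sum B S k x)"
proof -
  have re: "pdet B T = complex_of_real (Re (pdet B T))" if "T \<subseteq> S" for T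
    using pdet_herm_on[of T B] herm_on_subset[OF assms(2) that] finite_subset[OF that assms(1)] by blast
  have "coeff (pencil_poly B S x) k = (\<Sum>T\<in>Pow S. if card T = k then
      pdet B T * (\<Prod>i\<in>S - T. complex_of_real (x i)) else 0)"
    by (simp add: pencil_poly_def coeff_sum)
  also have "\<dots> = (\<Sum>T\<in>{T \<in> Pow S. card T = k}. pdet B T * (\<Prod>i\<in>S - T. complex_of_real (x i)))"
    using assms(1) by (intro sum.inter_filter[symmetric]) simp
  also have "\<dots> = (\<Sum>T | T \<subseteq> S \<and> card T = k. complex_of_real (Re (pdet B T) * (\<Prod>i\<in>S - T. x i)))"
    using re by (intro sum.cong) auto
  finally show ?thesis by (simp add: minor_sum_def)
qed

text \<open>
  For a kernel vector \<open>v\<close> of the matrix \<open>diag x + s B\<close>, the equation \<open>s H = - X\<close> holds with \<open>H = v\<^sup>* B v\<close> real and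
  \<open>X = v\<^sup>* (diag x) v\<close> positive.
\<close>

lemma real_rooted_pencil_poly:
  assumes S: "finite S" and B: "herm_on B S" and x: "\<And>i. i \<in> S \<Longrightarrow> x i > 0"
  shows "real_rooted (pencil_poly B S x)"
  unfolding real_rooted_def
proof (intro allI impI)
  fix s assume "poly (pencil_poly B S x) s = 0"
  then obtain v where v: "\<exists>i\<in>S. v i \<noteq> 0"
    and ker: "\<And>i. i \<in> S \<Longrightarrow> (\<Sum>j\<in>S. (s * B i j + (if i = j then complex_of_real (x i) else 0)) * v j) = 0"
    unfolding poly_pencil_poly[OF S] pdet_eq_0_iff[OF S] by blast
  define H where "H = (\<Sum>i\<in>S. \<Sum>j\<in>S. cnj (v i) * B i j * v j)"
  define X where "X = (\<Sum>i\<in>S. x i * (cmod (v i))\<^sup>2)"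
  have "cnj H = (\<Sum>i\<in>S. \<Sum>j\<in>S. cnj (v j) * B j i * v i)"
    unfolding H_def cnj_sum
  proof (intro sum.cong refl)
    fix i j assume "i \<in> S" "j \<in> S"
    then have "B j i = cnj (B i j)" by (intro herm_onD[OF B])
    then show "cnj (cnj (v i) * B i j * v j) = cnj (v j) * B j i * v i" by (simp add: mult_ac)
  qed
  also have "\<dots> = H" unfolding H_def by (rule sum.swap)
  finally have H: "H = complex_of_real (Re H)" by (simp add: complex_eq_iff)
  have X: "X > 0"
  proof -
    obtain i where "i \<in> S" "v i \<noteq> 0" using v by blast
    then have "x i * (cmod (v i))\<^sup>2 > 0" using x[of i] by simp
    moreover have "x i * (cmod (v i))\<^sup>2 \<ge> 0" if "i \<in> S" for i
      using less_imp_le[OF x[OF that]] by simp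
    ultimately show ?thesis unfolding X_def using \<open>i \<in> S\<close> by (intro sum_pos2[OF S])
  qed
  have "0 = (\<Sum>i\<in>S. cnj (v i) * (\<Sum>j\<in>S. (s * B i j + (if i = j then complex_of_real (x i) else 0)) * v j))"
    using ker by simp
  also have "\<dots> = (\<Sum>i\<in>S. s * (\<Sum>j\<in>S. cnj (v i) * B i j * v j) + complex_of_real (x i * (cmod (v i))\<^sup>2))"
  proof (rule sum.cong[OF refl])
    fix i assume i: "i \<in> S"
    let ?A = "\<Sum>j\<in>S. B i j * v j"
    have "(\<Sum>j\<in>S. (s * B i j + (if i = j then complex_of_real (x i) else 0)) * v j) =
        (\<Sum>j\<in>S. s * (B i j * v j) + (if i = j then complex_of_real (x i) * v j else 0))"
      by (intro sum.cong refl) (simp add: distrib_right)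
    also have "\<dots> = s * ?A + complex_of_real (x i) * v i"
      using S i by (simp add: sum.distrib sum_distrib_left)
    finally have row: "(\<Sum>j\<in>S. (s * B i j + (if i = j then complex_of_real (x i) else 0)) * v j) =
        s * ?A + complex_of_real (x i) * v i" .
    have A: "(\<Sum>j\<in>S. cnj (v i) * B i j * v j) = cnj (v i) * ?A"
      by (simp add: sum_distrib_left mult.assoc)
    show "cnj (v i) * (\<Sum>j\<in>S. (s * B i j + (if i = j then complex_of_real (x i) else 0)) * v j) =
        s * (\<Sum>j\<in>S. cnj (v i) * B i j * v j) + complex_of_real (x i * (cmod (v i))\<^sup>2)"
      unfolding row A of_real_mult complex_norm_square by (simp add: algebra_simps)
  qed
  also have "\<dots> = s * H + complex_of_real X"
    by (simp add: H_def X_def sum.distrib sum_distrib_left)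
  finally have eq: "s * complex_of_real (Re H) = - complex_of_real X"
    unfolding H[symmetric] by (simp add: eq_neg_iff_add_eq_0)
  then have "Re H \<noteq> 0" using X by auto
  then have "complex_of_real (Re H) \<noteq> 0" by simp
  then have "s = - complex_of_real X / complex_of_real (Re H)"
    by (rule nonzero_eq_divide_eq[THEN iffD2]) (rule eq)
  then have "s = complex_of_real (- X / Re H)" by simp
  then show "s \<in> \<real>" by (metis Reals_of_real)
qed

lemma minor_sum_0: "finite S \<Longrightarrow> minor_sum B S 0 x = (\<Prod>i\<in>S. x i)"
proof -
  assume "finite S"
  then have "{T. T \<subseteq> S \<and> card T = 0} = {{}}" by (auto simp: card_eq_0_iff dest: finite_subset)
  then show ?thesis by (simp add: minor_sum_def)
qed

lemma minor_sum_newton_at_zero: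
  assumes "finite S" "herm_on B S" "\<And>i. i \<in> S \<Longrightarrow> x i > 0" "minor_sum B S (Suc k) x = 0"
  shows "minor_sum B S k x * minor_sum B S (k + 2) x \<le> 0"
  by (rule real_rooted_newton_at_zero[OF real_rooted_pencil_poly[OF assms(1-3)]])
    (simp_all add: coeff_pencil_poly[OF assms(1,2)] assms(4))

lemma minor_sum_double_gap:
  assumes "finite S" "herm_on B S" "\<And>i. i \<in> S \<Longrightarrow> x i > 0"
    "minor_sum B S m x = 0" "minor_sum B S (Suc m) x = 0" "j \<ge> m"
  shows "minor_sum B S j x = 0"
proof -
  have "(\<Prod>i\<in>S. x i) > 0" by (rule prod_pos) (rule assms(3))
  then have c0: "coeff (pencil_poly B S x) 0 \<noteq> 0"
    by (simp add: coeff_pencil_poly[OF assms(1,2)] minor_sum_0[OF assms(1)] del: of_real_prod)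
  have cm: "coeff (pencil_poly B S x) m = 0" "coeff (pencil_poly B S x) (Suc m) = 0"
    by (simp_all add: coeff_pencil_poly[OF assms(1,2)] assms(4,5))
  have "coeff (pencil_poly B S x) j = 0"
    by (rule real_rooted_double_gap[OF real_rooted_pencil_poly[OF assms(1-3)] c0 cm assms(6)])
  then show ?thesis by (simp add: coeff_pencil_poly[OF assms(1,2)])
qed

text \<open>
  With weight \<open>1\<close> off \<open>T\<close> and a small weight \<open>e\<close> on \<open>T\<close>, the minor of \<open>T\<close> is the only one of its order whose
  coefficient survives as \<open>e\<close> tends to zero.  The factor \<open>c\<close> serves both signs.
\<close>

lemma minor_sum_approximates_minor:
  assumes S: "finite S" and T: "T \<subseteq> S" and pos: "c * Re (pdet B T) > 0"
  obtains x where "\<And>i. i \<in> S \<Longrightarrow> x i > 0" "c * minor_sum B S (card T) x > 0"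
proof -
  define X where "X e i = (if i \<in> T then e else 1 :: real)" for e i
  define h where "h e = c * minor_sum B S (card T) (X e)" for e
  have "minor_sum B S (card T) (X 0) = (\<Sum>U | U \<subseteq> S \<and> card U = card T. if U = T then Re (pdet B T) else 0)"
    unfolding minor_sum_def
  proof (rule sum.cong[OF refl])
    fix U assume U: "U \<in> {U. U \<subseteq> S \<and> card U = card T}"
    show "Re (pdet B U) * (\<Prod>i\<in>S - U. X 0 i) = (if U = T then Re (pdet B T) else 0)"
    proof (cases "T \<subseteq> U")
      case True
      then have "T = U" using U S by (intro card_subset_eq) (auto dest: finite_subset)
      then show ?thesis by (auto simp: X_def intro!: prod.neutral)
    next
      case False
      then obtain i where "i \<in> T" "i \<notin> U" by blast
      then have "(\<Prod>i\<in>S - U. X 0 i) = 0"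
        using S T by (intro prod_zero) (auto simp: X_def intro!: bexI[of _ i])
      then show ?thesis using False by auto
    qed
  qed
  also have "\<dots> = Re (pdet B T)" using S T by (simp add: sum.delta')
  finally have "h 0 > 0" using pos by (simp add: h_def)
  moreover have "(h \<longlongrightarrow> h 0) (at_right 0)"
  proof -
    have X_lim: "((\<lambda>e. X e i) \<longlongrightarrow> X 0 i) (at_right 0)" for i
      by (cases "i \<in> T") (simp_all add: X_def tendsto_ident_at)
    show ?thesis
      unfolding h_def minor_sum_def by (intro tendsto_intros X_lim)
  qed
  ultimately have "eventually (\<lambda>e. h e > 0) (at_right 0)"
    by (rule order_tendstoD(1)[rotated])
  then obtain b where b: "b > 0" "\<And>e. 0 < e \<Longrightarrow> e < b \<Longrightarrow> h e > 0"
    unfolding eventually_at_right_field by blast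
  define e where "e = b / 2"
  have "e > 0" "h e > 0" using b by (simp_all add: e_def)
  then show thesis using that[of "X e"] by (simp add: h_def X_def)
qed

text \<open>
  The positive orthant is convex, so the intermediate value theorem applies on a segment.
\<close>

lemma minor_sum_zero_exists:
  assumes S: "finite S" and T: "T \<subseteq> S" "card T = k" "Re (pdet B T) > 0"
    and U: "U \<subseteq> S" "card U = k" "Re (pdet B U) < 0"
  obtains x where "\<And>i. i \<in> S \<Longrightarrow> x i > 0" "minor_sum B S k x = 0"
proof -
  have "1 * Re (pdet B T) > 0" "(- 1) * Re (pdet B U) > 0" using T(3) U(3) by simp_all
  then obtain y z
    where y: "\<And>i. i \<in> S \<Longrightarrow> y i > 0" "1 * minor_sum B S (card T) y > 0"
      and z: "\<And>i. i \<in> S \<Longrightarrow> z i > 0" "(- 1) * minor_sum B S (card U) z > 0"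
    using minor_sum_approximates_minor[OF S T(1)] minor_sum_approximates_minor[OF S U(1)] by metis
  define X where "X t i = (1 - t) * z i + t * y i" for t i
  define g where "g t = minor_sum B S k (X t)" for t
  have "X 0 = z" "X 1 = y" by (auto simp: X_def)
  then have ends: "g 0 \<le> 0" "0 \<le> g 1" using y(2) z(2) T(2) U(2) by (simp_all add: g_def)
  have cont: "continuous_on {0..1} g"
    unfolding g_def minor_sum_def X_def by (intro continuous_intros)
  obtain t where t: "0 \<le> t" "t \<le> 1" "g t = 0"
    using IVT'[OF ends zero_le_one cont] by metis
  have pos: "X t i > 0" if i: "i \<in> S" for i
  proof -
    have "z i > 0" "y i > 0" using y(1)[OF i] z(1)[OF i] by blast+
    moreover have "t = 1 \<or> 1 - t > 0" using t(2) by argo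
    ultimately have "t = 1 \<and> y i > 0 \<or> (1 - t) * z i > 0 \<and> t * y i \<ge> 0"
      using t(1) mult_pos_pos[of "1 - t" "z i"] mult_nonneg_nonneg[of t "y i"] by argo
    then show ?thesis unfolding X_def by fastforce
  qed
  show thesis by (rule that[OF pos t(3)[unfolded g_def]])
qed

section \<open>The largest order with a nonzero minor\<close>

text \<open>
  A full-rank factorization \<open>B = W\<^sup>* B[G] W\<close> from principal minors alone.  Since \<open>B[G \<union> {x}]\<close> is singular,
  column \<open>x\<close> restricted to \<open>G \<union> {x}\<close> is a combination of the columns in \<open>G\<close>; let \<open>R y x\<close> be the error of this combination in
  row \<open>y\<close>.  Since also \<open>B[G \<union> {x, y}]\<close> is singular, \<open>R y x\<close> vanishes.
\<close>

lemma vanishing_minors_imp_factorization: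
  assumes S: "finite S" and B: "herm_on B S" and G: "G \<subseteq> S" "pdet B G \<noteq> 0"
    and zero: "\<And>T. T \<subseteq> S \<Longrightarrow> card T > card G \<Longrightarrow> pdet B T = 0"
  obtains W where "\<And>i j. i \<in> S \<Longrightarrow> j \<in> S \<Longrightarrow> B i j = (\<Sum>k\<in>G. (\<Sum>l\<in>G. cnj (W l i) * B l k) * W k j)"
proof -
  have fG: "finite G" using S G(1) finite_subset by blast
  have ex: "\<exists>w. \<forall>i\<in>insert x G. B i x + (\<Sum>j\<in>G. B i j * w j) = 0" if x: "x \<in> S - G" for x
  proof -
    have "pdet B (insert x G) = 0"
      using x G(1) fG by (intro zero) auto
    moreover have fx: "finite (insert x G)" using fG by simp
    ultimately obtain u where u: "\<exists>i\<in>insert x G. u i \<noteq> 0"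
      and ker: "\<And>i. i \<in> insert x G \<Longrightarrow> (\<Sum>j\<in>insert x G. B i j * u j) = 0"
      unfolding pdet_eq_0_iff[OF fx] by blast
    have ker': "B i x * u x + (\<Sum>j\<in>G. B i j * u j) = 0" if "i \<in> insert x G" for i
      using ker[OF that] x fG by simp
    have "u x \<noteq> 0"
    proof
      assume "u x = 0"
      with u ker' have "pdet B G = 0" by (subst pdet_eq_0_iff[OF fG]) (intro exI[of _ u], auto)
      with G(2) show False ..
    qed
    have "B i x + (\<Sum>j\<in>G. B i j * (u j / u x)) = 0" if "i \<in> insert x G" for i
    proof -
      have "(\<Sum>j\<in>G. B i j * (u j / u x)) = (\<Sum>j\<in>G. B i j * u j) / u x"
        by (simp add: sum_divide_distrib)
      also have "(\<Sum>j\<in>G. B i j * u j) = - (B i x * u x)"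
        using ker'[OF that] by (simp add: eq_neg_iff_add_eq_0 add.commute)
      also have "- (B i x * u x) / u x = - B i x" using \<open>u x \<noteq> 0\<close> by simp
      finally show ?thesis by simp
    qed
    then show ?thesis by (intro exI[of _ "\<lambda>j. u j / u x"] ballI)
  qed
  then have "\<forall>x\<in>S - G. \<exists>w. \<forall>i\<in>insert x G. B i x + (\<Sum>j\<in>G. B i j * w j) = 0" by blast
  from bchoice[OF this] obtain w
    where w: "\<And>x i. x \<in> S - G \<Longrightarrow> i \<in> insert x G \<Longrightarrow> B i x + (\<Sum>j\<in>G. B i j * w x j) = 0"
    by blast
  define R where "R y x = B y x + (\<Sum>j\<in>G. B y j * w x j)" for y x
  have R0: "R i x = 0" if "x \<in> S - G" "i \<in> insert x G" for i x
    using w[OF that] by (simp add: R_def)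
  have R_sym: "R y x = cnj (R x y)" if x: "x \<in> S - G" and y: "y \<in> S - G" for x y
  proof -
    have "(\<Sum>j\<in>G. B y j * w x j) = (\<Sum>j\<in>G. \<Sum>k\<in>G. - (cnj (w y k) * B k j * w x j))"
    proof (rule sum.cong[OF refl])
      fix j assume j: "j \<in> G"
      have "B y j = cnj (B j y)" using y j G(1) by (intro herm_onD[OF B]) auto
      also have "B j y = - (\<Sum>k\<in>G. B j k * w y k)"
        using w[OF y, of j] j by (simp add: add_eq_0_iff2)
      also have "cnj \<dots> = (\<Sum>k\<in>G. - (cnj (w y k) * B k j))"
        unfolding complex_cnj_minus cnj_sum sum_negf[symmetric]
      proof (rule sum.cong[OF refl])
        fix k assume "k \<in> G"
        then have "B k j = cnj (B j k)" using j G(1) by (intro herm_onD[OF B]) auto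
        then show "- cnj (B j k * w y k) = - (cnj (w y k) * B k j)" by simp
      qed
      finally show "B y j * w x j = (\<Sum>k\<in>G. - (cnj (w y k) * B k j * w x j))"
        by (simp add: sum_distrib_right sum_negf)
    qed
    also have "\<dots> = (\<Sum>k\<in>G. \<Sum>j\<in>G. - (cnj (w y k) * B k j * w x j))" by (rule sum.swap)
    also have "\<dots> = (\<Sum>k\<in>G. cnj (w y k) * B k x)"
    proof (rule sum.cong[OF refl])
      fix k assume k: "k \<in> G"
      have "B k x = - (\<Sum>j\<in>G. B k j * w x j)"
        using w[OF x, of k] k by (simp add: add_eq_0_iff2)
      then show "(\<Sum>j\<in>G. - (cnj (w y k) * B k j * w x j)) = cnj (w y k) * B k x"
        by (simp add: sum_negf sum_distrib_left mult.assoc)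
    qed
    also have "\<dots> = (\<Sum>k\<in>G. cnj (B x k * w y k))"
    proof (rule sum.cong[OF refl])
      fix k assume "k \<in> G"
      then have "B k x = cnj (B x k)" using x G(1) by (intro herm_onD[OF B]) auto
      then show "cnj (w y k) * B k x = cnj (B x k * w y k)" by simp
    qed
    moreover have "B y x = cnj (B x y)" using x y by (intro herm_onD[OF B]) auto
    ultimately show ?thesis unfolding R_def by simp
  qed
  have R: "R y x = 0" if x: "x \<in> S - G" and y: "y \<in> S" for x y
  proof (cases "y \<in> insert x G")
    case True
    then show ?thesis by (rule R0[OF x])
  next
    case False
    then have xy: "y \<in> S - G" "x \<noteq> y" using y by auto
    let ?K = "insert y (insert x G)"
    have "pdet B ?K = 0"
      using x xy G(1) fG by (intro zero) auto
    moreover have fK: "finite ?K" using fG by simp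
    ultimately obtain u where u: "\<exists>i\<in>?K. u i \<noteq> 0"
      and ker: "\<And>i. i \<in> ?K \<Longrightarrow> (\<Sum>j\<in>?K. B i j * u j) = 0"
      unfolding pdet_eq_0_iff[OF fK] by blast
    have ker': "B i y * u y + (B i x * u x + (\<Sum>j\<in>G. B i j * u j)) = 0" if "i \<in> ?K" for i
      using ker[OF that] x xy fG by simp
    \<comment> \<open>Replacing columns \<open>x\<close> and \<open>y\<close> by their combinations turns the kernel vector into one on \<open>G\<close>, which is zero.\<close>
    define z where "z j = u j - u x * w x j - u y * w y j" for j
    have z_row: "(\<Sum>j\<in>G. B i j * z j) + u y * R i y + u x * R i x = 0" if "i \<in> ?K" for i
    proof -
      have "(\<Sum>j\<in>G. B i j * z j) = (\<Sum>j\<in>G. B i j * u j) - u x * (\<Sum>j\<in>G. B i j * w x j) - u y * (\<Sum>j\<in>G. B i j * w y j)"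
      proof -
        have "(\<Sum>j\<in>G. B i j * z j) =
            (\<Sum>j\<in>G. B i j * u j - u x * (B i j * w x j) - u y * (B i j * w y j))"
          by (intro sum.cong refl) (simp add: z_def algebra_simps)
        then show ?thesis by (simp only: sum_subtractf sum_distrib_left)
      qed
      then show ?thesis using ker'[OF that] by (simp add: R_def algebra_simps)
    qed
    have z0: "z j = 0" if "j \<in> G" for j
    proof (rule ccontr)
      assume "z j \<noteq> 0"
      moreover have "(\<Sum>j\<in>G. B i j * z j) = 0" if "i \<in> G" for i
        using z_row[of i] R0[OF x, of i] R0[OF xy(1), of i] that by simp
      ultimately have "pdet B G = 0"
        using \<open>j \<in> G\<close> by (subst pdet_eq_0_iff[OF fG]) (intro exI[of _ z], auto)
      with G(2) show False ..
    qed
    have uxy: "u x \<noteq> 0 \<or> u y \<noteq> 0"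
    proof (rule ccontr)
      assume "\<not> ?thesis"
      then have "u j = 0" if "j \<in> ?K" for j using that z0[of j] by (auto simp: z_def)
      with u show False by blast
    qed
    have "u x * R y x = 0" using z_row[of y] z0 R0[OF xy(1), of y] by simp
    moreover have "u y * R x y = 0" using z_row[of x] z0 R0[OF x, of x] by simp
    ultimately show ?thesis using uxy R_sym[OF x xy(1)] by auto
  qed
  define W where "W k x = (if x \<in> G then (if k = x then 1 else 0) else - w x k)" for k x
  have col: "B i x = (\<Sum>k\<in>G. B i k * W k x)" if "i \<in> S" "x \<in> S" for i x
  proof (cases "x \<in> G")
    case True
    have "(\<Sum>k\<in>G. B i k * W k x) = (\<Sum>k\<in>G. if k = x then B i k else 0)"
      using True by (intro sum.cong refl) (simp add: W_def)
    then show ?thesis using True fG by simp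
  next
    case False
    then show ?thesis using R[of x i] that by (simp add: W_def R_def sum_negf add_eq_0_iff2)
  qed
  show thesis
  proof (rule that[of W])
    fix i j assume ij: "i \<in> S" "j \<in> S"
    have row: "B i k = (\<Sum>l\<in>G. cnj (W l i) * B l k)" if k: "k \<in> G" for k
    proof -
      have kS: "k \<in> S" using k G(1) by auto
      have "B i k = cnj (B k i)" by (rule herm_onD[OF B ij(1) kS])
      also have "\<dots> = (\<Sum>l\<in>G. cnj (B k l * W l i))" by (simp only: col[OF kS ij(1)] cnj_sum)
      also have "\<dots> = (\<Sum>l\<in>G. cnj (W l i) * B l k)"
      proof (rule sum.cong[OF refl])
        fix l assume "l \<in> G"
        then have "B l k = cnj (B k l)" using kS G(1) by (intro herm_onD[OF B]) auto
        then show "cnj (B k l * W l i) = cnj (W l i) * B l k" by simp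
      qed
      finally show ?thesis .
    qed
    show "B i j = (\<Sum>k\<in>G. (\<Sum>l\<in>G. cnj (W l i) * B l k) * W k j)"
      unfolding col[OF ij] by (intro sum.cong refl) (simp only: row)
  qed
qed

text \<open>
  By the factorization, the minor of \<open>D\<close> is \<open>\<bar>det W[G, D]\<bar>\<^sup>2\<close> times that of \<open>G\<close>.
\<close>

lemma top_minors_same_sign:
  assumes S: "finite S" and B: "herm_on B S" and G: "G \<subseteq> S" "pdet B G \<noteq> 0"
    and zero: "\<And>T. T \<subseteq> S \<Longrightarrow> card T > card G \<Longrightarrow> pdet B T = 0"
    and D: "D \<subseteq> S" "card D = card G"
  shows "Re (pdet B D) * Re (pdet B G) \<ge> 0"
proof -
  obtain W where W: "\<And>i j. i \<in> S \<Longrightarrow> j \<in> S \<Longrightarrow> B i j = (\<Sum>k\<in>G. (\<Sum>l\<in>G. cnj (W l i) * B l k) * W k j)"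
    using vanishing_minors_imp_factorization[OF S B G zero] by blast
  have fG: "finite G" and fD: "finite D" using S G(1) D(1) finite_subset by blast+
  obtain h where h: "bij_betw h G D" using D(2) fG fD by (metis finite_same_card_bij)
  have hS: "h i \<in> S" if "i \<in> G" for i using h that D(1) by (auto simp: bij_betw_def)
  let ?V = "\<lambda>k j. W k (h j)"
  have "pdet B D = pdet (\<lambda>i j. B (h i) (h j)) G" by (rule pdet_reindex[OF h fG])
  also have "\<dots> = pdet (\<lambda>i j. \<Sum>k\<in>G. (\<Sum>l\<in>G. cnj (?V l i) * B l k) * ?V k j) G"
    using W hS by (intro pdet_cong) simp
  also have "\<dots> = pdet (\<lambda>i l. cnj (?V l i)) G * pdet B G * pdet ?V G"
    using pdet_mult[OF fG, of "\<lambda>i k. \<Sum>l\<in>G. cnj (?V l i) * B l k" ?V]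
      pdet_mult[OF fG, of "\<lambda>i l. cnj (?V l i)" B] by simp
  also have "pdet (\<lambda>i l. cnj (?V l i)) G = cnj (pdet ?V G)"
    unfolding pdet_transpose[OF fG, where B = "\<lambda>i l. cnj (?V i l)"] by (rule pdet_cnj)
  also have "cnj (pdet ?V G) * pdet B G * pdet ?V G = complex_of_real ((cmod (pdet ?V G))\<^sup>2) * pdet B G"
    unfolding complex_norm_square by (simp add: mult_ac)
  finally have "Re (pdet B D) = (cmod (pdet ?V G))\<^sup>2 * Re (pdet B G)" by (simp del: of_real_power)
  then show ?thesis by (simp add: mult.assoc)
qed

text \<open>
  Otherwise take the largest order with a nonzero minor.  Its coefficient vanishes at \<open>x\<close> by the
  double gap, although all its summands are of one sign and not all of them are zero.
\<close>

lemma minor_sum_double_zero_imp_minors_vanish: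
  assumes S: "finite S" and B: "herm_on B S" and x: "\<And>i. i \<in> S \<Longrightarrow> x i > 0"
    and zero: "minor_sum B S m x = 0" "minor_sum B S (Suc m) x = 0"
    and T: "T \<subseteq> S" "card T \<ge> m"
  shows "pdet B T = 0"
proof (rule ccontr)
  assume T0: "pdet B T \<noteq> 0"
  define P where "P r \<longleftrightarrow> (\<exists>T\<subseteq>S. card T = r \<and> pdet B T \<noteq> 0)" for r
  have bound: "r \<le> card S" if "P r" for r using that S unfolding P_def by (auto intro: card_mono)
  define r where "r = (GREATEST r. P r)"
  have "P (card T)" using T T0 unfolding P_def by blast
  have "P r" "card T \<le> r"
    unfolding r_def using GreatestI_nat[of P, OF \<open>P (card T)\<close> bound]
      Greatest_le_nat[of P, OF \<open>P (card T)\<close> bound] by blast+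
  then obtain G where G: "G \<subseteq> S" "card G = r" "pdet B G \<noteq> 0" unfolding P_def by blast
  have top: "pdet B U = 0" if "U \<subseteq> S" "card U > card G" for U
  proof (rule ccontr)
    assume "pdet B U \<noteq> 0"
    then have "P (card U)" using that(1) unfolding P_def by blast
    then have "card U \<le> r" unfolding r_def by (rule Greatest_le_nat) (rule bound)
    then show False using that(2) G(2) by simp
  qed
  have fG: "finite G" using S G(1) finite_subset by blast
  have sign: "Re (pdet B U) * Re (pdet B G) \<ge> 0" if "U \<subseteq> S" "card U = r" for U
    by (rule top_minors_same_sign[OF S B G(1,3) top that(1)]) (simp_all add: that(2) G(2))
  have nz: "Re (pdet B G) \<noteq> 0"
    using G(3) pdet_herm_on[OF fG herm_on_subset[OF B G(1)]] by (metis of_real_0)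
  have px: "(\<Prod>i\<in>S - U. x i) > 0" for U using x by (intro prod_pos) auto
  have "0 < (\<Sum>U | U \<subseteq> S \<and> card U = r. Re (pdet B U) * Re (pdet B G) * (\<Prod>i\<in>S - U. x i))"
  proof (rule sum_pos2[of _ G])
    show "finite {U. U \<subseteq> S \<and> card U = r}" using S by simp
    show "G \<in> {U. U \<subseteq> S \<and> card U = r}" using G by simp
    have "0 < Re (pdet B G) * Re (pdet B G)" using nz not_real_square_gt_zero by blast
    then show "0 < Re (pdet B G) * Re (pdet B G) * (\<Prod>i\<in>S - G. x i)"
      using px by (rule mult_pos_pos)
    show "0 \<le> Re (pdet B U) * Re (pdet B G) * (\<Prod>i\<in>S - U. x i)" if "U \<in> {U. U \<subseteq> S \<and> card U = r}" for U
      using that by (intro mult_nonneg_nonneg[OF sign less_imp_le[OF px]]) auto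
  qed
  also have "\<dots> = Re (pdet B G) * minor_sum B S r x"
    by (simp add: minor_sum_def sum_distrib_left mult_ac)
  finally have "minor_sum B S r x \<noteq> 0" by auto
  moreover have "minor_sum B S r x = 0"
    using T(2) \<open>card T \<le> r\<close> by (intro minor_sum_double_gap[OF S B x zero]) auto
  ultimately show False by contradiction
qed

section \<open>A zero minor inside a nonsingular submatrix\<close>

lemma pdet_replace_identity_column:
  assumes S: "finite S" and j: "j \<in> S"
  shows "pdet (\<lambda>k l. if l = j then v k else if k = l then 1 else 0) S = (v j :: 'a::comm_ring_1)"
proof -
  let ?M = "\<lambda>k l. if l = j then v k else if k = l then 1 else 0"
  have "(\<Sum>p | p permutes S. of_int (sign p) * (\<Prod>i\<in>S. ?M i (p i))) =
      (\<Sum>p\<in>{id}. of_int (sign p) * (\<Prod>i\<in>S. ?M i (p i)))"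
  proof (rule sum.mono_neutral_right)
    show "\<forall>p\<in>{p. p permutes S} - {id}. of_int (sign p) * (\<Prod>i\<in>S. ?M i (p i)) = 0"
    proof
      fix p assume p: "p \<in> {p. p permutes S} - {id}"
      have "\<exists>k\<in>S. p k \<noteq> j \<and> p k \<noteq> k"
      proof (rule ccontr)
        assume *: "\<not> ?thesis"
        have inj: "inj p" using p permutes_inj by auto
        have fixed: "p k = k" if k: "k \<in> S" "k \<noteq> j" for k
        proof (rule ccontr)
          assume "p k \<noteq> k"
          with * k have "p k = j" by blast
          then have "p j \<noteq> j" using inj k(2) by (metis injD)
          with * j show False by blast
        qed
        have "p j = j"
        proof (rule ccontr)
          assume "p j \<noteq> j"
          moreover have "p j \<in> S" using p j permutes_in_image by fastforce
          ultimately have "p (p j) = p j" by (intro fixed)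
          then have "p j = j" by (rule injD[OF inj])
          with \<open>p j \<noteq> j\<close> show False ..
        qed
        then have "p k = k" if "k \<in> S" for k using that fixed by (cases "k = j") auto
        moreover have "p k = k" if "k \<notin> S" for k using p that permutes_not_in by fastforce
        ultimately have "p = id" by (auto simp: fun_eq_iff)
        with p show False by blast
      qed
      then obtain k where "k \<in> S" "p k \<noteq> j" "p k \<noteq> k" by blast
      then have "(\<Prod>i\<in>S. ?M i (p i)) = 0"
        using S by (intro prod_zero) (auto intro!: bexI[of _ k])
      then show "of_int (sign p) * (\<Prod>i\<in>S. ?M i (p i)) = 0" by simp
    qed
    show "finite {p. p permutes S}" using S by (rule finite_permutations)
    show "{id} \<subseteq> {p. p permutes S}" using permutes_id by simp
  qed
  also have "\<dots> = (\<Prod>i\<in>S. if i = j then v j else 1)"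
    by (auto intro!: prod.cong)
  also have "\<dots> = v j" using S j by simp
  finally show ?thesis unfolding pdet_def .
qed

text \<open>
  Only permutations that exchange \<open>i\<close> and \<open>j\<close> contribute.
\<close>

lemma pdet_sparse_row_column:
  fixes N :: "'i \<Rightarrow> 'i \<Rightarrow> 'a::idom"
  assumes S: "finite S" and ij: "i \<in> S" "j \<in> S" "i \<noteq> j"
    and row: "\<And>l. l \<in> S \<Longrightarrow> N j l = (if l = i then a else 0)"
    and col: "\<And>k. k \<in> S \<Longrightarrow> N k j = (if k = i then b else 0)"
  shows "pdet N S = - (a * b) * pdet N (S - {i, j})"
proof -
  let ?t = "transpose i j"
  let ?Q = "{q. q permutes S - {i, j}}"
  let ?f = "\<lambda>p. of_int (sign p) * (\<Prod>k\<in>S. N k (p k))"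
  have t: "?t permutes S" using ij by (intro permutes_swap_id)
  have inj: "inj_on (\<lambda>q. ?t \<circ> q) ?Q"
    by (rule inj_onI) (metis comp_assoc swap_id_idempotent id_comp transpose_comp_involutory)
  have "(\<Sum>p | p permutes S. ?f p) = (\<Sum>p\<in>(\<lambda>q. ?t \<circ> q) ` ?Q. ?f p)"
  proof (rule sum.mono_neutral_right)
    show "finite {p. p permutes S}" using S by (rule finite_permutations)
    show "(\<lambda>q. ?t \<circ> q) ` ?Q \<subseteq> {p. p permutes S}"
      using t permutes_subset[of _ "S - {i, j}" S] by (auto intro: permutes_compose)
    show "\<forall>p\<in>{p. p permutes S} - (\<lambda>q. ?t \<circ> q) ` ?Q. ?f p = 0"
    proof
      fix p assume p: "p \<in> {p. p permutes S} - (\<lambda>q. ?t \<circ> q) ` ?Q"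
      have pS: "p permutes S" using p by blast
      have "\<not> (p i = j \<and> p j = i)"
      proof
        assume *: "p i = j \<and> p j = i"
        have "(?t \<circ> p) permutes S - {i, j}"
        proof (rule permutes_superset)
          show "(?t \<circ> p) permutes S" using pS t by (rule permutes_compose)
        qed (use * in auto)
        moreover have "p = ?t \<circ> (?t \<circ> p)" by (simp add: fun_eq_iff)
        ultimately show False using p by blast
      qed
      moreover obtain k where k: "k \<in> S" "p k = j"
        using permutes_inverses(1)[OF pS, of j] permutes_in_image[OF permutes_inv[OF pS], of j] ij(2) by blast
      ultimately have "(\<exists>k\<in>S. N k (p k) = 0)"
        using row[of "p j"] col[of k] pS ij by (metis permutes_in_image)
      then have "(\<Prod>k\<in>S. N k (p k)) = 0" using S by (intro prod_zero)
      then show "?f p = 0" by simp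
    qed
  qed
  also have "\<dots> = (\<Sum>q\<in>?Q. ?f (?t \<circ> q))" by (simp add: sum.reindex[OF inj])
  also have "\<dots> = (\<Sum>q\<in>?Q. - (a * b) * (of_int (sign q) * (\<Prod>k\<in>S - {i, j}. N k (q k))))"
  proof (rule sum.cong[OF refl])
    fix q assume "q \<in> ?Q"
    then have q: "q permutes S - {i, j}" by simp
    have qi: "q i = i" "q j = j" using permutes_not_in[OF q] by auto
    have "permutation q" using q S by (auto simp: permutation_permutes)
    then have "sign (?t \<circ> q) = - sign q"
      using ij(3) by (simp add: sign_compose permutation_swap_id sign_swap_id)
    moreover have "(\<Prod>k\<in>S. N k ((?t \<circ> q) k)) = N i j * N j i * (\<Prod>k\<in>S - {i, j}. N k ((?t \<circ> q) k))"
    proof -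
      have "S = insert i (insert j (S - {i, j}))" using ij by blast
      then have "(\<Prod>k\<in>S. N k ((?t \<circ> q) k)) = (\<Prod>k\<in>insert i (insert j (S - {i, j})). N k ((?t \<circ> q) k))" by simp
      also have "\<dots> = N i ((?t \<circ> q) i) * (N j ((?t \<circ> q) j) * (\<Prod>k\<in>S - {i, j}. N k ((?t \<circ> q) k)))"
        using S ij(3) by simp
      finally show ?thesis by (simp add: qi mult_ac)
    qed
    moreover have "(\<Prod>k\<in>S - {i, j}. N k ((?t \<circ> q) k)) = (\<Prod>k\<in>S - {i, j}. N k (q k))"
    proof (rule prod.cong[OF refl])
      fix k assume "k \<in> S - {i, j}"
      then have "q k \<in> S - {i, j}" using permutes_in_image[OF q] by blast
      then show "N k ((?t \<circ> q) k) = N k (q k)" by (simp add: transpose_def)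
    qed
    moreover have "N i j = b" "N j i = a" using row[OF ij(1)] col[OF ij(1)] by simp_all
    ultimately show "?f (?t \<circ> q) = - (a * b) * (of_int (sign q) * (\<Prod>k\<in>S - {i, j}. N k (q k)))"
      by (simp add: mult_ac)
  qed
  finally show ?thesis by (simp add: pdet_def sum_distrib_left)
qed

text \<open>
  Take a nonzero kernel vector \<open>v\<close> of \<open>B[S - {i}]\<close>, extended by \<open>v\<^sub>i = 0\<close>; then \<open>B v = c e\<^sub>i\<close>.  Choose \<open>j\<close> with \<open>v\<^sub>j \<noteq> 0\<close>
  and let \<open>M\<close> be the identity matrix with \<open>v\<close> in column \<open>j\<close>.  In \<open>M\<^sup>* B M\<close>, row and column \<open>j\<close> have a single nonzero entry, at
  position \<open>i\<close>, so that \<open>\<bar>v\<^sub>j\<bar>\<^sup>2 det B[S] = - \<bar>c\<bar>\<^sup>2 det B[S - {i, j}]\<close>.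
\<close>

lemma singular_codimension_one_minor:
  assumes S: "finite S" and B: "herm_on B S" and D: "pdet B S \<noteq> 0"
    and i: "i \<in> S" and zero: "pdet B (S - {i}) = 0"
  obtains j where "j \<in> S - {i}" "Re (pdet B (S - {i, j})) * Re (pdet B S) < 0"
proof -
  have fin: "finite (S - {i})" using S by simp
  obtain v0 where v0: "\<exists>k\<in>S - {i}. v0 k \<noteq> 0" "\<And>k. k \<in> S - {i} \<Longrightarrow> (\<Sum>l\<in>S - {i}. B k l * v0 l) = 0"
    using zero unfolding pdet_eq_0_iff[OF fin] by blast
  define v where "v k = (if k = i then 0 else v0 k)" for k
  have vi: "v i = 0" by (simp add: v_def)
  have Bv: "(\<Sum>l\<in>S. B k l * v l) = (\<Sum>l\<in>S - {i}. B k l * v0 l)" for k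
    using S i by (subst sum.remove[of S i]) (auto simp: v_def intro!: sum.cong)
  define c where "c = (\<Sum>l\<in>S. B i l * v l)"
  have Bv': "(\<Sum>l\<in>S. B k l * v l) = (if k = i then c else 0)" if "k \<in> S" for k
    using that v0(2)[of k] by (auto simp: Bv c_def)
  obtain j where j: "j \<in> S" "j \<noteq> i" "v j \<noteq> 0" using v0(1) by (auto simp: v_def)
  define M where "M k l = (if l = j then v k else if k = l then 1 else 0)" for k l
  \<comment> \<open>\<open>N = M\<^sup>* B M\<close>\<close>
  define N where "N k l = (\<Sum>b\<in>S. (\<Sum>a\<in>S. cnj (M a k) * B a b) * M b l)" for k l
  have left: "(\<Sum>a\<in>S. cnj (M a k) * B a b) = (if k = j then cnj (\<Sum>a\<in>S. B b a * v a) else B k b)"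
    if kb: "k \<in> S" "b \<in> S" for k b
  proof (cases "k = j")
    case True
    have "(\<Sum>a\<in>S. cnj (v a) * B a b) = (\<Sum>a\<in>S. cnj (B b a * v a))"
    proof (rule sum.cong[OF refl])
      fix a assume "a \<in> S"
      then have "B a b = cnj (B b a)" using kb(2) by (intro herm_onD[OF B])
      then show "cnj (v a) * B a b = cnj (B b a * v a)" by simp
    qed
    then show ?thesis using True by (simp add: M_def cnj_sum)
  next
    case False
    then have "(\<Sum>a\<in>S. cnj (M a k) * B a b) = (\<Sum>a\<in>S. if a = k then B a b else 0)"
      by (intro sum.cong) (auto simp: M_def)
    then show ?thesis using False S kb(1) by simp
  qed
  have left': "(\<Sum>a\<in>S. cnj (M a k) * B a b) = (if k = j then (if b = i then cnj c else 0) else B k b)"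
    if "k \<in> S" "b \<in> S" for k b
    using left[OF that] Bv'[OF that(2)] by simp
  have N: "N k l = (if k = j then (if l = i then cnj c else 0) else if l = j then (if k = i then c else 0) else B k l)"
    if kl: "k \<in> S" "l \<in> S" for k l
  proof -
    have N1: "N k l = (\<Sum>b\<in>S. (if k = j then (if b = i then cnj c else 0) else B k b) * M b l)"
      unfolding N_def by (intro sum.cong refl) (simp add: left'[OF kl(1)])
    show ?thesis
    proof (cases "k = j")
      case True
      then have "N k l = (\<Sum>b\<in>S. if b = i then cnj c * M i l else 0)"
        unfolding N1 by (intro sum.cong) auto
      also have "\<dots> = cnj c * M i l" using S i by simp
      finally show ?thesis using True vi j(2) by (auto simp: M_def)
    next
      case False
      show ?thesis
      proof (cases "l = j")
        case True
        then show ?thesis using False j(2) Bv'[OF kl(1)] unfolding N1 by (simp add: M_def)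
      next
        case l: False
        then have "N k l = (\<Sum>b\<in>S. if b = l then B k l else 0)"
          unfolding N1 using False by (intro sum.cong) (auto simp: M_def)
        then show ?thesis using False l S kl(2) by simp
      qed
    qed
  qed
  have "pdet N S = pdet (\<lambda>k a. cnj (M a k)) S * pdet B S * pdet M S"
    unfolding N_def
    using pdet_mult[OF S, of "\<lambda>k b. \<Sum>a\<in>S. cnj (M a k) * B a b" M]
      pdet_mult[OF S, of "\<lambda>k a. cnj (M a k)" B] by simp
  also have "pdet (\<lambda>k a. cnj (M a k)) S = cnj (pdet M S)"
    unfolding pdet_transpose[OF S, where B = "\<lambda>k a. cnj (M k a)"] by (rule pdet_cnj)
  also have "pdet M S = v j"
    unfolding M_def by (rule pdet_replace_identity_column[OF S j(1)])
  finally have "pdet N S = complex_of_real ((cmod (v j))\<^sup>2) * pdet B S"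
    unfolding complex_norm_square by (simp add: mult_ac)
  moreover have "pdet N S = - (cnj c * c) * pdet N (S - {i, j})"
    by (rule pdet_sparse_row_column[OF S i j(1)]) (use N i j in auto)
  moreover have "pdet N (S - {i, j}) = pdet B (S - {i, j})"
    by (rule pdet_cong) (simp add: N)
  moreover have "- (cnj c * c) = complex_of_real (- (cmod c)\<^sup>2)"
    unfolding of_real_minus complex_norm_square by (simp add: mult.commute)
  ultimately have "complex_of_real ((cmod (v j))\<^sup>2) * pdet B S = complex_of_real (- (cmod c)\<^sup>2) * pdet B (S - {i, j})"
    by simp
  from arg_cong[OF this, of Re] have eq: "(cmod (v j))\<^sup>2 * Re (pdet B S) = - ((cmod c)\<^sup>2) * Re (pdet B (S - {i, j}))"
    by (simp del: of_real_power of_real_minus)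
  have "Re (pdet B S) \<noteq> 0" using D pdet_herm_on[OF S B] by (metis of_real_0)
  then have pos: "(cmod (v j))\<^sup>2 * (Re (pdet B S))\<^sup>2 > 0" using j(3) by simp
  have "(cmod c)\<^sup>2 * (Re (pdet B (S - {i, j})) * Re (pdet B S)) = - ((cmod (v j))\<^sup>2 * (Re (pdet B S))\<^sup>2)"
    using arg_cong[OF eq, of "\<lambda>t. t * Re (pdet B S)"] by (simp add: power2_eq_square mult_ac)
  with pos have "(cmod c)\<^sup>2 * (Re (pdet B (S - {i, j})) * Re (pdet B S)) < 0" by linarith
  then have "Re (pdet B (S - {i, j})) * Re (pdet B S) < 0"
    by (simp add: mult_less_0_iff zero_less_power2 not_less) 
  then show thesis using j by (intro that) auto
qed

section \<open>Excluded triples\<close>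

lemma hermitian_mat_imp_herm_on:
  assumes "hermitian_mat B" "B \<in> carrier_mat n n"
  shows "herm_on (\<lambda>i j. B $$ (i, j)) {..<n}"
  unfolding herm_on_def using assms(2) by (intro ballI hermitian_mat_index[OF assms(1)]) auto

lemma principal_minors_eq:
  assumes "B \<in> carrier_mat n n"
  shows "principal_minors B k = (\<lambda>T. Re (pdet (\<lambda>i j. B $$ (i, j)) T)) ` {T. T \<subseteq> {..<n} \<and> card T = k}"
  using assms det_submatrix_eq_pdet[OF assms]
  unfolding principal_minors_def by (auto simp: image_def) metis+

lemma sepr_term_cond:
  "k \<le> dim_row B \<Longrightarrow> sepr_cond (principal_minors B k) (sepr_term B k)"
  unfolding sepr_term_def using sepr_term_unique by (rule theI')

lemma sublist_sepr_3:
  assumes "sublist [a, b, c] (sepr B)"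
  obtains p where "1 \<le> p" "p + 2 \<le> dim_row B"
    "a = sepr_term B p" "b = sepr_term B (Suc p)" "c = sepr_term B (p + 2)"
proof -
  obtain us vs where eq: "sepr B = us @ [a, b, c] @ vs" using assms unfolding sublist_def by blast
  have len: "length us + 3 + length vs = dim_row B" using arg_cong[OF eq, of length] by (simp add: sepr_def del: upt_Suc)
  have nth: "sepr B ! k = sepr_term B (Suc k)" if "k < dim_row B" for k
    using that by (simp add: sepr_def del: upt_Suc)
  have "sepr B ! length us = a" "sepr B ! Suc (length us) = b" "sepr B ! (length us + 2) = c"
    unfolding eq by (simp_all add: nth_append)
  then show thesis using len nth[of "length us"] nth[of "Suc (length us)"] nth[of "length us + 2"]
    by (intro that[of "Suc (length us)"]) auto
qed

context
  fixes B :: "complex mat" and n :: nat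
  assumes B: "hermitian_mat B" "B \<in> carrier_mat n n"
begin

abbreviation (input) "Bf \<equiv> \<lambda>i j. B $$ (i, j)"

text \<open>
  At every positive \<open>x\<close> the coefficients of the two outer orders have the strict sign of \<open>c\<close>, so
  the middle one is never zero.  It would be zero everywhere if all its minors were, and somewhere if they had both
  signs.
\<close>

lemma same_signs_two_apart:
  assumes c: "\<And>x. x \<in> principal_minors B k \<Longrightarrow> c * x \<ge> 0" "\<exists>x\<in>principal_minors B k. c * x > 0"
    "\<And>x. x \<in> principal_minors B (k + 2) \<Longrightarrow> c * x \<ge> 0" "\<exists>x\<in>principal_minors B (k + 2). c * x > 0"
  shows "\<exists>x\<in>principal_minors B (Suc k). x \<noteq> 0"
    and "\<not> ((\<exists>x\<in>principal_minors B (Suc k). x > 0) \<and> (\<exists>x\<in>principal_minors B (Suc k). x < 0))"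
proof -
  note pm = principal_minors_eq[OF B(2)]
  note H = hermitian_mat_imp_herm_on[OF B]
  have pos: "c * minor_sum Bf {..<n} j x > 0"
    if x: "\<And>i. i \<in> {..<n} \<Longrightarrow> x i > 0"
      and j: "\<And>y. y \<in> principal_minors B j \<Longrightarrow> c * y \<ge> 0" "\<exists>y\<in>principal_minors B j. c * y > 0" for j x
  proof -
    have px: "(\<Prod>i\<in>{..<n} - U. x i) > 0" for U using x by (intro prod_pos) auto
    obtain T where T: "T \<subseteq> {..<n}" "card T = j" "c * Re (pdet Bf T) > 0" using j(2) unfolding pm by blast
    have "0 < (\<Sum>T | T \<subseteq> {..<n} \<and> card T = j. c * Re (pdet Bf T) * (\<Prod>i\<in>{..<n} - T. x i))"
    proof (rule sum_pos2[of _ T])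
      show "0 \<le> c * Re (pdet Bf U) * (\<Prod>i\<in>{..<n} - U. x i)" if "U \<in> {T. T \<subseteq> {..<n} \<and> card T = j}" for U
        using that j(1) unfolding pm by (intro mult_nonneg_nonneg[OF _ less_imp_le[OF px]]) blast
      show "0 < c * Re (pdet Bf T) * (\<Prod>i\<in>{..<n} - T. x i)" using T(3) px by (rule mult_pos_pos)
    qed (use T in auto)
    then show ?thesis by (simp add: minor_sum_def sum_distrib_left mult.assoc)
  qed
  have nonzero: "minor_sum Bf {..<n} (Suc k) x \<noteq> 0" if x: "\<And>i. i \<in> {..<n} \<Longrightarrow> x i > 0" for x
  proof
    assume "minor_sum Bf {..<n} (Suc k) x = 0"
    then have le: "minor_sum Bf {..<n} k x * minor_sum Bf {..<n} (k + 2) x \<le> 0"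
      by (intro minor_sum_newton_at_zero[OF finite_lessThan H x])
    have "c * minor_sum Bf {..<n} k x > 0" "c * minor_sum Bf {..<n} (k + 2) x > 0"
      by (intro pos x c; assumption)+
    then have "(c * minor_sum Bf {..<n} k x) * (c * minor_sum Bf {..<n} (k + 2) x) > 0" by (rule mult_pos_pos)
    then have "c\<^sup>2 * (minor_sum Bf {..<n} k x * minor_sum Bf {..<n} (k + 2) x) > 0"
      by (simp add: power2_eq_square mult_ac)
    moreover have "c\<^sup>2 * (minor_sum Bf {..<n} k x * minor_sum Bf {..<n} (k + 2) x) \<le> 0"
      using le by (rule mult_nonneg_nonpos[OF zero_le_power2])
    ultimately show False by linarith
  qed
  show "\<exists>x\<in>principal_minors B (Suc k). x \<noteq> 0"
  proof (rule ccontr)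
    assume "\<not> ?thesis"
    then have "minor_sum Bf {..<n} (Suc k) (\<lambda>_. 1) = 0"
      unfolding pm minor_sum_def by (intro sum.neutral) auto
    then show False using nonzero[of "\<lambda>_. 1"] by simp
  qed
  show "\<not> ((\<exists>x\<in>principal_minors B (Suc k). x > 0) \<and> (\<exists>x\<in>principal_minors B (Suc k). x < 0))"
  proof
    assume "(\<exists>x\<in>principal_minors B (Suc k). x > 0) \<and> (\<exists>x\<in>principal_minors B (Suc k). x < 0)"
    then obtain T U where "T \<subseteq> {..<n}" "card T = Suc k" "Re (pdet Bf T) > 0"
      "U \<subseteq> {..<n}" "card U = Suc k" "Re (pdet Bf U) < 0" unfolding pm by blast
    then obtain x where "\<And>i. i \<in> {..<n} \<Longrightarrow> x i > 0" "minor_sum Bf {..<n} (Suc k) x = 0"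
      by (rule minor_sum_zero_exists[OF finite_lessThan]) (rule that)
    then show False using nonzero by blast
  qed
qed

text \<open>
  Here order \<open>k\<close> is of type \<open>N\<close> and the adjacent order \<open>k'\<close> of type \<open>N\<close>, \<open>A\<^sup>*\<close> or \<open>S\<^sup>*\<close>.
\<close>

lemma common_zero_imp_minors_vanish:
  assumes "k' = Suc k \<or> k = Suc k'"
    and "\<forall>x\<in>principal_minors B k. x = 0"
    and "(\<forall>x\<in>principal_minors B k'. x = 0) \<or>
      (\<exists>x\<in>principal_minors B k'. x > 0) \<and> (\<exists>x\<in>principal_minors B k'. x < 0)"
    and j: "j \<ge> min k k'"
  shows "\<forall>x\<in>principal_minors B j. x = 0"
proof -
  note pm = principal_minors_eq[OF B(2)]
  note H = hermitian_mat_imp_herm_on[OF B]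
  have zero: "minor_sum Bf {..<n} i x = 0" if "\<forall>y\<in>principal_minors B i. y = 0" for i x
    using that unfolding pm minor_sum_def by (intro sum.neutral) auto
  obtain x where x: "\<And>i. i \<in> {..<n} \<Longrightarrow> x i > 0" "minor_sum Bf {..<n} k' x = 0"
  proof (cases "\<forall>x\<in>principal_minors B k'. x = 0")
    case True
    show thesis by (rule that[of "\<lambda>_. 1"]) (simp_all add: zero[OF True])
  next
    case False
    with assms(3) obtain T U where "T \<subseteq> {..<n}" "card T = k'" "Re (pdet Bf T) > 0"
      "U \<subseteq> {..<n}" "card U = k'" "Re (pdet Bf U) < 0" unfolding pm by blast
    then show thesis by (rule minor_sum_zero_exists[OF finite_lessThan]) (rule that)
  qed
  have "minor_sum Bf {..<n} (min k k') x = 0" "minor_sum Bf {..<n} (Suc (min k k')) x = 0"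
    using assms(1) x(2) zero[OF assms(2), of x] by auto
  then have "pdet Bf T = 0" if "T \<subseteq> {..<n}" "card T = j" for T
    using that j by (intro minor_sum_double_zero_imp_minors_vanish[OF finite_lessThan H x(1)]) auto
  then show ?thesis unfolding pm by auto
qed

text \<open>
  Any further index enlarges the index set of the zero minor to one of a nonsingular submatrix.
\<close>

lemma zero_minor_below_nonsingular:
  assumes "k + 2 \<le> n" "0 \<in> principal_minors B (Suc k)" "0 \<notin> principal_minors B (k + 2)"
  obtains x y where "x \<in> principal_minors B k" "y \<in> principal_minors B (k + 2)" "x * y < 0"
proof -
  note pm = principal_minors_eq[OF B(2)]
  note H = hermitian_mat_imp_herm_on[OF B]
  have mem: "Re (pdet Bf T) \<in> principal_minors B j" if "T \<subseteq> {..<n}" "card T = j" for T j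
    using that unfolding pm by blast
  obtain T where T: "T \<subseteq> {..<n}" "card T = Suc k" and T0: "0 = Re (pdet Bf T)"
    using assms(2) unfolding pm by blast
  have fT: "finite T" using T(1) finite_subset by blast
  have "T \<noteq> {..<n}" using T(2) assms(1) by auto
  then obtain i where i: "i < n" "i \<notin> T" using T(1) by blast
  let ?D = "insert i T"
  have D: "?D \<subseteq> {..<n}" "card ?D = k + 2" "finite ?D" "?D - {i} = T" using T i fT by auto
  have HD: "herm_on Bf ?D" by (rule herm_on_subset[OF H D(1)])
  have "Re (pdet Bf ?D) \<noteq> 0" using assms(3) mem[OF D(1,2)] by auto
  then have "pdet Bf ?D \<noteq> 0" by auto
  moreover have "pdet Bf (?D - {i}) = 0"
    unfolding D(4) using T0 pdet_herm_on[OF fT herm_on_subset[OF H T(1)]] by simp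
  ultimately obtain j where j: "j \<in> ?D - {i}" "Re (pdet Bf (?D - {i, j})) * Re (pdet Bf ?D) < 0"
    using singular_codimension_one_minor[OF D(3) HD] by blast
  have "?D - {i, j} = T - {j}" "j \<in> T" using i j(1) by auto
  then have "card (?D - {i, j}) = k" using T(2) fT by simp
  moreover have "?D - {i, j} \<subseteq> {..<n}" using D(1) by blast
  ultimately show thesis by (intro that[OF mem mem[OF D(1,2)] j(2)])
qed

end

text \<open>
  The four conditions as one predicate on triples, in a form that can be evaluated.
\<close>

definition excluded :: "sepr_sym list \<Rightarrow> bool" where
  "excluded \<sigma> \<longleftrightarrow>
     (\<exists>X \<in> {Astar, Nsym, Sstar, Splus, Sminus}.
        \<sigma> \<in> {[Aplus, X, Aplus], [Aminus, X, Aminus], [Splus, X, Aplus], [Sminus, X, Aminus]})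
     \<or> (\<exists>Y \<in> {Astar, Nsym, Sstar}.
        \<sigma> \<in> {[Aplus, Y, Splus], [Aminus, Y, Sminus], [Splus, Y, Splus], [Sminus, Y, Sminus]})
     \<or> (sublist [Astar, Nsym] \<sigma> \<or> sublist [Nsym, Astar] \<sigma>
        \<or> sublist [Sstar, Nsym] \<sigma> \<or> sublist [Nsym, Sstar] \<sigma>)
     \<or> uepr \<sigma> \<in> {[UeprN, UeprN, UeprA], [UeprN, UeprN, UeprS], [UeprN, UeprS, UeprA]}"

text \<open>
  The factors \<open>1\<close> and \<open>- 1\<close> let both signs share \<open>same_signs_two_apart\<close>.
\<close>

lemma sepr_cond_weak_sign:
  assumes "sepr_cond M t" "M \<noteq> {}"
  shows "t \<in> {Aplus, Splus} \<Longrightarrow> (\<forall>x\<in>M. 1 * x \<ge> 0) \<and> (\<exists>x\<in>M. 1 * x > 0)"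
    and "t \<in> {Aminus, Sminus} \<Longrightarrow> (\<forall>x\<in>M. -1 * x \<ge> 0) \<and> (\<exists>x\<in>M. -1 * x > 0)"
  using assms by (auto simp: less_imp_le) (metis less_eq_real_def neg_le_0_iff_le)+

lemma sublist_2_of_3: "sublist [x, y] [a, b, c] \<longleftrightarrow> (x = a \<and> y = b) \<or> (x = b \<and> y = c)"
  by (auto simp: sublist_code)

lemma strip_sign_iff:
  "strip_sign t = UeprN \<longleftrightarrow> t = Nsym"
  "strip_sign t = UeprA \<longleftrightarrow> t \<in> {Astar, Aplus, Aminus}"
  "strip_sign t = UeprS \<longleftrightarrow> t \<in> {Sstar, Splus, Sminus}"
  by (cases t; simp)+

lemma excluded_cases:
  assumes "excluded [a, b, c]"
  obtains
    (A) "a \<in> {Aplus, Splus} \<and> c = Aplus \<or> a \<in> {Aminus, Sminus} \<and> c = Aminus" "b \<in> {Astar, Nsym, Sstar, Splus, Sminus}"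
  | (S) "a \<in> {Aplus, Splus} \<and> c = Splus \<or> a \<in> {Aminus, Sminus} \<and> c = Sminus" "b \<in> {Astar, Nsym, Sstar}"
  | (ab) "a = Nsym \<and> b \<in> {Astar, Sstar} \<or> b = Nsym \<and> a \<in> {Astar, Sstar}"
  | (bc) "b = Nsym \<and> c \<in> {Astar, Sstar} \<or> c = Nsym \<and> b \<in> {Astar, Sstar}"
  | (NN) "a = Nsym" "b = Nsym" "c \<noteq> Nsym"
  | (NSA) "a = Nsym" "b \<in> {Sstar, Splus, Sminus}" "c \<in> {Astar, Aplus, Aminus}"
proof -
  from assms consider
    (1) "\<exists>X \<in> {Astar, Nsym, Sstar, Splus, Sminus}.
        [a, b, c] \<in> {[Aplus, X, Aplus], [Aminus, X, Aminus], [Splus, X, Aplus], [Sminus, X, Aminus]}"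
  | (2) "\<exists>Y \<in> {Astar, Nsym, Sstar}.
        [a, b, c] \<in> {[Aplus, Y, Splus], [Aminus, Y, Sminus], [Splus, Y, Splus], [Sminus, Y, Sminus]}"
  | (3) "sublist [Astar, Nsym] [a, b, c] \<or> sublist [Nsym, Astar] [a, b, c]
        \<or> sublist [Sstar, Nsym] [a, b, c] \<or> sublist [Nsym, Sstar] [a, b, c]"
  | (4) "uepr [a, b, c] \<in> {[UeprN, UeprN, UeprA], [UeprN, UeprN, UeprS], [UeprN, UeprS, UeprA]}"
    unfolding excluded_def by argo
  then show thesis
  proof cases
    case 1
    then show ?thesis by (intro A) auto
  next
    case 2
    then show ?thesis by (intro S) auto
  next
    case 3
    then have "(a = Nsym \<and> b \<in> {Astar, Sstar} \<or> b = Nsym \<and> a \<in> {Astar, Sstar}) \<or>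
      (b = Nsym \<and> c \<in> {Astar, Sstar} \<or> c = Nsym \<and> b \<in> {Astar, Sstar})"
      unfolding sublist_2_of_3 by auto
    then show ?thesis using ab bc by argo
  next
    case 4
    then have "a = Nsym \<and> b = Nsym \<and> c \<noteq> Nsym \<or>
        a = Nsym \<and> b \<in> {Sstar, Splus, Sminus} \<and> c \<in> {Astar, Aplus, Aminus}"
      unfolding uepr_def by (auto simp: strip_sign_iff)
    then show ?thesis using NN NSA by argo
  qed
qed

lemma principal_minors_nonempty: "k \<le> dim_row B \<Longrightarrow> principal_minors B k \<noteq> {}"
proof -
  assume "k \<le> dim_row B"
  then have "{..<k} \<subseteq> {..<dim_row B} \<and> card {..<k} = k" by auto
  then show ?thesis unfolding principal_minors_def by blast
qed

lemma excluded_not_attained: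
  assumes B: "hermitian_mat B" "B \<in> carrier_mat n n" and sub: "sublist [a, b, c] (sepr B)"
  shows "\<not> excluded [a, b, c]"
proof
  assume ex: "excluded [a, b, c]"
  obtain p where p: "p + 2 \<le> n" and abc: "a = sepr_term B p" "b = sepr_term B (Suc p)" "c = sepr_term B (p + 2)"
    by (rule sublist_sepr_3[OF sub]) (use B(2) in simp)
  define M where "M i = principal_minors B (p + i)" for i
  have conds: "sepr_cond (M 0) a" "sepr_cond (M 1) b" "sepr_cond (M 2) c"
    using p B(2) sepr_term_cond[of _ B] unfolding M_def abc by auto
  have ne: "M 0 \<noteq> {}" "M 1 \<noteq> {}" "M 2 \<noteq> {}"
    using p B(2) principal_minors_nonempty[of _ B] unfolding M_def by auto
  have two_apart: "(\<exists>x\<in>M 1. x \<noteq> 0) \<and> \<not> ((\<exists>x\<in>M 1. x > 0) \<and> (\<exists>x\<in>M 1. x < 0))"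
    if "\<forall>x\<in>M 0. s * x \<ge> 0" "\<exists>x\<in>M 0. s * x > 0" "\<forall>x\<in>M 2. s * x \<ge> 0" "\<exists>x\<in>M 2. s * x > 0" for s
    using same_signs_two_apart[OF B, of p s] that unfolding M_def by auto
  have vanish: "\<forall>x\<in>M l. x = 0"
    if "j = Suc i \<or> i = Suc j" "\<forall>x\<in>M i. x = 0"
      "(\<forall>x\<in>M j. x = 0) \<or> (\<exists>x\<in>M j. x > 0) \<and> (\<exists>x\<in>M j. x < 0)" "l \<ge> min i j" for i j l
    using common_zero_imp_minors_vanish[OF B, of "p + j" "p + i" "p + l"] that unfolding M_def by auto
  have below: "\<exists>x\<in>M 0. \<exists>y\<in>M 2. x * y < 0" if "0 \<in> M 1" "0 \<notin> M 2"
  proof -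
    have "0 \<in> principal_minors B (Suc p)" "0 \<notin> principal_minors B (p + 2)"
      using that unfolding M_def by simp_all
    then obtain x y where "x \<in> principal_minors B p" "y \<in> principal_minors B (p + 2)" "x * y < 0"
      by (rule zero_minor_below_nonsingular[OF B p])
    then show ?thesis unfolding M_def by auto
  qed
  have weak: "\<exists>s. (\<forall>x\<in>M 0. s * x \<ge> 0) \<and> (\<exists>x\<in>M 0. s * x > 0) \<and> (\<forall>x\<in>M 2. s * x \<ge> 0) \<and> (\<exists>x\<in>M 2. s * x > 0)"
    if "a \<in> {Aplus, Splus} \<and> c \<in> {Aplus, Splus} \<or> a \<in> {Aminus, Sminus} \<and> c \<in> {Aminus, Sminus}"
    using that
  proof
    assume "a \<in> {Aplus, Splus} \<and> c \<in> {Aplus, Splus}"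
    then show ?thesis
      using sepr_cond_weak_sign(1)[OF conds(1) ne(1)] sepr_cond_weak_sign(1)[OF conds(3) ne(3)]
      by (intro exI[of _ 1]) blast
  next
    assume "a \<in> {Aminus, Sminus} \<and> c \<in> {Aminus, Sminus}"
    then show ?thesis
      using sepr_cond_weak_sign(2)[OF conds(1) ne(1)] sepr_cond_weak_sign(2)[OF conds(3) ne(3)]
      by (intro exI[of _ "- 1"]) blast
  qed
  have no_star: "b \<notin> {Astar, Nsym, Sstar}"
    if "a \<in> {Aplus, Splus} \<and> c \<in> {Aplus, Splus} \<or> a \<in> {Aminus, Sminus} \<and> c \<in> {Aminus, Sminus}"
  proof -
    have M1: "\<exists>x\<in>M 1. x \<noteq> 0" "\<not> ((\<exists>x\<in>M 1. x > 0) \<and> (\<exists>x\<in>M 1. x < 0))"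
      using weak[OF that] two_apart by blast+
    show ?thesis
    proof
      assume "b \<in> {Astar, Nsym, Sstar}"
      then consider "b = Astar" | "b = Nsym" | "b = Sstar" by blast
      then show False using M1 conds(2) by cases auto
    qed
  qed
  have mixed: "(\<exists>x\<in>M i. x > 0) \<and> (\<exists>x\<in>M i. x < 0)" if "sepr_cond (M i) t" "t \<in> {Astar, Sstar}" for i t
    using that by auto
  show False using ex
  proof (cases rule: excluded_cases)
    case A
    then have "b \<in> {Splus, Sminus}" using no_star by auto
    then have "0 \<in> M 1" using conds(2) by auto
    moreover have "0 \<notin> M 2" using A(1) conds(3) by auto
    ultimately obtain x y where xy: "x \<in> M 0" "y \<in> M 2" "x * y < 0" using below by blast
    show False using A(1)
    proof
      assume "a \<in> {Aplus, Splus} \<and> c = Aplus"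
      then have "x \<ge> 0" "y \<ge> 0" using sepr_cond_weak_sign(1)[OF conds(1) ne(1)] conds(3) xy(1,2) by (auto simp: less_imp_le)
      then show False using xy(3) mult_nonneg_nonneg[of x y] by linarith
    next
      assume "a \<in> {Aminus, Sminus} \<and> c = Aminus"
      then have "x \<le> 0" "y \<le> 0" using sepr_cond_weak_sign(2)[OF conds(1) ne(1)] conds(3) xy(1,2) by (auto simp: less_imp_le)
      then show False using xy(3) mult_nonpos_nonpos[of x y] by linarith
    qed
  next
    case S
    then show False using no_star by auto
  next
    case ab
    then show False
    proof
      assume *: "a = Nsym \<and> b \<in> {Astar, Sstar}"
      have mix: "(\<exists>x\<in>M 1. x > 0) \<and> (\<exists>x\<in>M 1. x < 0)" using mixed[OF conds(2)] * by blast
      have "\<forall>x\<in>M 0. x = 0" using conds(1) * by simp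
      then have "\<forall>x\<in>M 1. x = 0" using mix by (intro vanish[of 1 0 1]) simp_all
      with mix show False by (metis less_irrefl)
    next
      assume *: "b = Nsym \<and> a \<in> {Astar, Sstar}"
      have mix: "(\<exists>x\<in>M 0. x > 0) \<and> (\<exists>x\<in>M 0. x < 0)" using mixed[OF conds(1)] * by blast
      have "\<forall>x\<in>M 1. x = 0" using conds(2) * by simp
      then have "\<forall>x\<in>M 0. x = 0" using mix by (intro vanish[of 0 1 0]) simp_all
      with mix show False by (metis less_irrefl)
    qed
  next
    case bc
    then show False
    proof
      assume *: "b = Nsym \<and> c \<in> {Astar, Sstar}"
      have mix: "(\<exists>x\<in>M 2. x > 0) \<and> (\<exists>x\<in>M 2. x < 0)" using mixed[OF conds(3)] * by blast
      have "\<forall>x\<in>M 1. x = 0" using conds(2) * by simp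
      then have "\<forall>x\<in>M 2. x = 0" using mix by (intro vanish[of 2 1 2]) simp_all
      with mix show False by (metis less_irrefl)
    next
      assume *: "c = Nsym \<and> b \<in> {Astar, Sstar}"
      have mix: "(\<exists>x\<in>M 1. x > 0) \<and> (\<exists>x\<in>M 1. x < 0)" using mixed[OF conds(2)] * by blast
      have "\<forall>x\<in>M 2. x = 0" using conds(3) * by simp
      then have "\<forall>x\<in>M 1. x = 0" using mix by (intro vanish[of 1 2 1]) simp_all
      with mix show False by (metis less_irrefl)
    qed
  next
    case NN
    then have "\<forall>x\<in>M 0. x = 0" "\<forall>x\<in>M 1. x = 0" using conds(1,2) by simp_all
    then have "\<forall>x\<in>M 2. x = 0" by (intro vanish[of 1 0 2]) simp_all
    then show False using NN(3) conds(3) ne(3) by (cases c) auto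
  next
    case NSA
    then have "0 \<in> M 1" "0 \<notin> M 2" "\<forall>x\<in>M 0. x = 0" using conds by auto
    with below show False by (metis less_irrefl mult_zero_left)
  qed
qed

section \<open>Evaluating the minors of an integer witness\<close>

text \<open>
  Pairs of integers stand for Gaussian integers, so that determinants can be computed by rewriting.
\<close>

definition gauss :: "int \<times> int \<Rightarrow> complex" where
  "gauss z = Complex (of_int (fst z)) (of_int (snd z))"

fun gauss_times :: "int \<times> int \<Rightarrow> int \<times> int \<Rightarrow> int \<times> int" where
  "gauss_times (a, b) (c, d) = (a * c - b * d, a * d + b * c)"

fun gauss_minus :: "int \<times> int \<Rightarrow> int \<times> int \<Rightarrow> int \<times> int" where
  "gauss_minus (a, b) (c, d) = (a - c, b - d)"

lemma gauss_simps [simp]: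
  "gauss (0, 0) = 0" "gauss (1, 0) = 1"
  "gauss (gauss_times x y) = gauss x * gauss y" "gauss (gauss_minus x y) = gauss x - gauss y"
  by (cases x; cases y; simp add: gauss_def complex_eq_iff)+

fun removals :: "'a list \<Rightarrow> ('a \<times> 'a list) list" where
  "removals [] = []"
| "removals (x # xs) = (x, xs) # map (\<lambda>(y, ys). (y, x # ys)) (removals xs)"

primrec altsum :: "(int \<times> int) list \<Rightarrow> int \<times> int" where
  "altsum [] = (0, 0)"
| "altsum (x # xs) = gauss_minus x (altsum xs)"

text \<open>
  The argument is a list of columns; expansion is along the first row, and a zero entry skips
  its cofactor.
\<close>

primrec laplace_det :: "nat \<Rightarrow> (int \<times> int) list list \<Rightarrow> int \<times> int" where
  "laplace_det 0 cs = (1, 0)"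
| "laplace_det (Suc n) cs = altsum (map (\<lambda>(c, cs').
     if hd c = (0, 0) then (0, 0) else gauss_times (hd c) (laplace_det n (map tl cs'))) (removals cs))"

lemma removals_nth:
  "length (removals xs) = length xs"
  "j < length xs \<Longrightarrow> removals xs ! j = (xs ! j, take j xs @ drop (Suc j) xs)"
proof (induction xs arbitrary: j)
  case (Cons x xs)
  { case 1 then show ?case using Cons by simp }
  { case 2 then show ?case using Cons by (cases j) simp_all }
qed simp_all

lemma gauss_altsum: "gauss (altsum xs) = (\<Sum>j<length xs. (- 1) ^ j * gauss (xs ! j))"
  by (induction xs) (simp_all add: sum.lessThan_Suc_shift sum_negf del: sum.lessThan_Suc)

lemma gauss_laplace_det:
  assumes "length cs = n" "\<forall>c\<in>set cs. length c = n"
  shows "gauss (laplace_det n cs) = det (mat n n (\<lambda>(i, j). gauss (cs ! j ! i)))"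
  using assms
proof (induction n arbitrary: cs)
  case 0
  then show ?case by (simp add: det_dim_zero)
next
  case (Suc n)
  let ?A = "mat (Suc n) (Suc n) (\<lambda>(i, j). gauss (cs ! j ! i))"
  have hd: "hd (cs ! j) = cs ! j ! 0" if "j < Suc n" for j
    using Suc.prems that by (intro hd_conv_nth) (metis length_0_conv nat.distinct(1) nth_mem)
  have minor: "gauss (laplace_det n (map tl (take j cs @ drop (Suc j) cs))) = det (mat_delete ?A 0 j)"
    if j: "j < Suc n" for j
  proof -
    let ?cs = "map tl (take j cs @ drop (Suc j) cs)"
    have len: "length ?cs = n" using Suc.prems(1) j by simp
    have cols: "\<forall>c\<in>set ?cs. length c = n"
      using Suc.prems(2) by (auto dest!: in_set_takeD in_set_dropD)
    have "mat_delete ?A 0 j = mat n n (\<lambda>(i, j). gauss (?cs ! j ! i))"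
    proof (rule eq_matI)
      fix i k assume "i < dim_row (mat n n (\<lambda>(i, j). gauss (?cs ! j ! i)))"
        "k < dim_col (mat n n (\<lambda>(i, j). gauss (?cs ! j ! i)))"
      then have ik: "i < n" "k < n" by auto
      define k' where "k' = (if k < j then k else Suc k)"
      have "(take j cs @ drop (Suc j) cs) ! k = cs ! k'"
        using Suc.prems(1) j ik(2) by (auto simp: k'_def nth_append min_def)
      then have "?cs ! k = tl (cs ! k')" using len ik(2) by (subst nth_map) auto
      moreover have k': "k' < Suc n" using ik by (simp add: k'_def)
      moreover have "length (cs ! k') = Suc n" using Suc.prems k' by simp
      ultimately show "mat_delete ?A 0 j $$ (i, k) = mat n n (\<lambda>(i, j). gauss (?cs ! j ! i)) $$ (i, k)"
        using ik by (simp add: mat_delete_def k'_def nth_tl)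
    qed (simp_all add: mat_delete_def)
    then show ?thesis using Suc.IH[OF len cols] by simp
  qed
  have "gauss (laplace_det (Suc n) cs) = (\<Sum>j<Suc n. (- 1) ^ j * (gauss (cs ! j ! 0) * det (mat_delete ?A 0 j)))"
    unfolding laplace_det.simps gauss_altsum
  proof (rule sum.cong)
    fix j assume "j \<in> {..<Suc n}"
    then have j: "j < Suc n" by simp
    let ?c = "cs ! j" and ?cs = "map tl (take j cs @ drop (Suc j) cs)"
    have "gauss (if hd ?c = (0, 0) then (0, 0) else gauss_times (hd ?c) (laplace_det n ?cs)) =
        gauss (?c ! 0) * gauss (laplace_det n ?cs)"
      using hd[OF j] by auto
    then show "(- 1) ^ j * gauss (map (\<lambda>(c, cs').
          if hd c = (0, 0) then (0, 0) else gauss_times (hd c) (laplace_det n (map tl cs'))) (removals cs) ! j) =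
        (- 1) ^ j * (gauss (cs ! j ! 0) * det (mat_delete ?A 0 j))"
      using minor[OF j] j Suc.prems(1) by (simp add: removals_nth)
  qed (simp add: removals_nth Suc.prems(1))
  also have "\<dots> = (\<Sum>j<Suc n. ?A $$ (0, j) * cofactor ?A 0 j)"
    by (rule sum.cong) (simp_all add: cofactor_def)
  also have "\<dots> = det ?A"
    by (rule laplace_expansion_row[symmetric]) auto
  finally show ?case .
qed

text \<open>
  Row \<open>i\<close> of \<open>R\<close> lists the real parts of the entries \<open>(i, i), (i, i + 1), \<dots>\<close>, and row \<open>i\<close> of \<open>I\<close> the
  imaginary parts of \<open>(i, i + 1), (i, i + 2), \<dots>\<close>; the empty list \<open>I\<close> stands for a real matrix.  The lower triangle is
  filled in by conjugation, so the matrix is Hermitian whatever the lists are.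
\<close>

definition entry :: "int list list \<Rightarrow> int list list \<Rightarrow> nat \<Rightarrow> nat \<Rightarrow> int \<times> int" where
  "entry R I i j =
    (if i < j then (R ! i ! (j - i), if I = [] then 0 else I ! i ! (j - i - 1))
     else if i = j then (R ! i ! 0, 0)
     else (R ! j ! (i - j), if I = [] then 0 else - (I ! j ! (i - j - 1))))"

definition witness_mat :: "int list list \<Rightarrow> int list list \<Rightarrow> complex mat" where
  "witness_mat R I = mat (length R) (length R) (\<lambda>(i, j). gauss (entry R I i j))"

lemma hermitian_matI:
  assumes "B \<in> carrier_mat n n" "\<And>i j. i < n \<Longrightarrow> j < n \<Longrightarrow> B $$ (i, j) = cnj (B $$ (j, i))"
  shows "hermitian_mat B"
proof -
  have "mat_adjoint B = B"
  proof (rule eq_matI)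
    fix i j assume "i < dim_row B" "j < dim_col B"
    then have ij: "i < n" "j < n" using assms(1) by auto
    then have "mat_adjoint B $$ (i, j) = cnj (B $$ (j, i))"
      using assms(1) unfolding mat_adjoint_def by (simp add: mat_of_rows_def)
    then show "mat_adjoint B $$ (i, j) = B $$ (i, j)" using assms(2)[OF ij] by simp
  qed (use assms(1) in \<open>auto simp: mat_adjoint_def\<close>)
  then show ?thesis using assms(1) unfolding hermitian_mat_def by auto
qed

lemma witness_mat_carrier: "witness_mat R I \<in> carrier_mat (length R) (length R)"
  by (simp add: witness_mat_def)

lemma witness_mat_hermitian: "hermitian_mat (witness_mat R I)"
  by (rule hermitian_matI[OF witness_mat_carrier])
    (auto simp: witness_mat_def entry_def gauss_def complex_eq_iff)

fun combinations :: "nat \<Rightarrow> 'a list \<Rightarrow> 'a list list" where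
  "combinations 0 xs = [[]]"
| "combinations (Suc k) [] = []"
| "combinations (Suc k) (x # xs) = map ((#) x) (combinations k xs) @ combinations (Suc k) xs"

lemma combinations_sound:
  assumes "ys \<in> set (combinations k xs)" "distinct xs"
  shows "length ys = k \<and> distinct ys \<and> set ys \<subseteq> set xs"
  using assms by (induction k xs arbitrary: ys rule: combinations.induct) fastforce+

lemma combinations_complete:
  assumes "T \<subseteq> set xs" "card T = k" "distinct xs"
  shows "\<exists>ys\<in>set (combinations k xs). set ys = T"
  using assms
proof (induction k xs arbitrary: T rule: combinations.induct)
  case (1 xs)
  then have "T = {}" using finite_subset by fastforce
  then show ?case by simp
next
  case (2 k)
  then show ?case by simp
next
  case (3 k x xs)
  show ?case
  proof (cases "x \<in> T")
    case True
    have "finite T" using 3(3) finite_subset by blast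
    then have "card (T - {x}) = k" using 3(4) True by simp
    moreover have "T - {x} \<subseteq> set xs" "distinct xs" using 3(3,5) by auto
    ultimately obtain ys where "ys \<in> set (combinations k xs)" "set ys = T - {x}"
      using 3(1)[of "T - {x}"] by blast
    then show ?thesis using True by (intro bexI[of _ "x # ys"]) auto
  next
    case False
    then have "T \<subseteq> set xs" "distinct xs" using 3(3,5) by auto
    then obtain ys where "ys \<in> set (combinations (Suc k) xs)" "set ys = T"
      using 3(2)[of T] 3(4) by blast
    then show ?thesis by auto
  qed
qed

definition minor_list :: "int list list \<Rightarrow> int list list \<Rightarrow> nat \<Rightarrow> int list" where
  "minor_list R I k =
    map (\<lambda>xs. fst (laplace_det k (map (\<lambda>j. map (\<lambda>i. entry R I i j) xs) xs))) (combinations k [0..<length R])"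

lemma principal_minors_witness_mat:
  "principal_minors (witness_mat R I) k = real_of_int ` set (minor_list R I k)"
proof -
  let ?n = "length R"
  let ?b = "\<lambda>i j. witness_mat R I $$ (i, j)"
  have minor: "Re (pdet ?b (set xs)) = real_of_int (fst (laplace_det k (map (\<lambda>j. map (\<lambda>i. entry R I i j) xs) xs)))"
    if xs: "xs \<in> set (combinations k [0..<?n])" for xs
  proof -
    have len: "length xs = k" and dist: "distinct xs" and sub: "set xs \<subseteq> {..<?n}"
      using combinations_sound[OF xs] by auto
    have "bij_betw ((!) xs) {0..<k} (set xs)"
      using dist len by (intro bij_betw_nth) auto
    then have "pdet ?b (set xs) = det (mat k k (\<lambda>(i, j). ?b (xs ! i) (xs ! j)))"
      by (rule pdet_eq_det)
    also have "mat k k (\<lambda>(i, j). ?b (xs ! i) (xs ! j)) =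
        mat k k (\<lambda>(i, j). gauss (map (\<lambda>j. map (\<lambda>i. entry R I i j) xs) xs ! j ! i))"
    proof (rule cong_mat[OF refl refl])
      fix i j assume "i < k" "j < k"
      moreover from this have "xs ! i < ?n" "xs ! j < ?n" using sub len nth_mem by blast+
      ultimately show "(case (i, j) of (i, j) \<Rightarrow> ?b (xs ! i) (xs ! j)) =
          (case (i, j) of (i, j) \<Rightarrow> gauss (map (\<lambda>j. map (\<lambda>i. entry R I i j) xs) xs ! j ! i))"
        by (simp add: witness_mat_def len)
    qed
    also have "det \<dots> = gauss (laplace_det k (map (\<lambda>j. map (\<lambda>i. entry R I i j) xs) xs))"
      by (rule gauss_laplace_det[symmetric]) (auto simp: len)
    finally show ?thesis by (simp add: gauss_def)
  qed
  have "{T. T \<subseteq> {..<?n} \<and> card T = k} = set ` set (combinations k [0..<?n])"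
  proof (intro equalityI subsetI)
    fix T assume "T \<in> {T. T \<subseteq> {..<?n} \<and> card T = k}"
    then show "T \<in> set ` set (combinations k [0..<?n])"
      using combinations_complete[of T "[0..<?n]" k] by (auto simp: atLeast0LessThan)
  next
    fix T assume "T \<in> set ` set (combinations k [0..<?n])"
    then obtain ys where "ys \<in> set (combinations k [0..<?n])" "T = set ys" by blast
    then show "T \<in> {T. T \<subseteq> {..<?n} \<and> card T = k}"
      using combinations_sound[of ys k "[0..<?n]"] by (auto simp: distinct_card)
  qed
  then have "principal_minors (witness_mat R I) k =
      (\<lambda>xs. Re (pdet ?b (set xs))) ` set (combinations k [0..<?n])"
    unfolding principal_minors_eq[OF witness_mat_carrier] by (simp add: image_image)
  also have "\<dots> = (\<lambda>xs. real_of_int (fst (laplace_det k (map (\<lambda>j. map (\<lambda>i. entry R I i j) xs) xs)))) `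
      set (combinations k [0..<?n])"
    by (rule image_cong[OF refl minor])
  finally show ?thesis by (simp add: minor_list_def image_image)
qed

definition classify :: "int list \<Rightarrow> sepr_sym" where
  "classify xs =
    (let p = list_ex (\<lambda>x. x > 0) xs; n = list_ex (\<lambda>x. x < 0) xs in
     if list_ex (\<lambda>x. x = 0) xs
     then if p then (if n then Sstar else Splus) else (if n then Sminus else Nsym)
     else if p then (if n then Astar else Aplus) else Aminus)"

lemma sepr_cond_signs:
  "sepr_cond M
    (if \<exists>x\<in>M. x = 0
     then if \<exists>x\<in>M. x > 0 then (if \<exists>x\<in>M. x < 0 then Sstar else Splus)
       else (if \<exists>x\<in>M. x < 0 then Sminus else Nsym)
     else if \<exists>x\<in>M. x > 0 then (if \<exists>x\<in>M. x < 0 then Astar else Aplus) else Aminus)"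
proof -
  have tri: "x < 0 \<or> x = 0 \<or> x > 0" for x :: real by auto
  show ?thesis
    by (cases "\<exists>x\<in>M. x = 0"; cases "\<exists>x\<in>M. x > 0"; cases "\<exists>x\<in>M. x < 0";
        simp only: if_True if_False sepr_cond.simps; use tri in \<open>metis less_irrefl\<close>)
qed

lemma sepr_cond_classify: "sepr_cond (real_of_int ` set xs) (classify xs)"
  using sepr_cond_signs[of "real_of_int ` set xs"]
  unfolding classify_def Let_def list_ex_iff
  by (simp only: bex_simps of_int_0_less_iff of_int_less_0_iff of_int_eq_0_iff)

definition sepr_list :: "int list list \<Rightarrow> int list list \<Rightarrow> sepr_sym list" where
  "sepr_list R I = map (\<lambda>k. classify (minor_list R I k)) [1..<Suc (length R)]"

lemma sepr_witness_mat: "sepr (witness_mat R I) = sepr_list R I"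
proof -
  have "sepr_term (witness_mat R I) k = classify (minor_list R I k)" if "k \<le> length R" for k
  proof -
    have "\<exists>!t. sepr_cond (principal_minors (witness_mat R I) k) t"
      using that by (intro sepr_term_unique) (simp add: witness_mat_def)
    moreover have "sepr_cond (principal_minors (witness_mat R I) k) (classify (minor_list R I k))"
      unfolding principal_minors_witness_mat by (rule sepr_cond_classify)
    ultimately show ?thesis unfolding sepr_term_def by (rule the1_equality)
  qed
  moreover have "dim_row (witness_mat R I) = length R" by (simp add: witness_mat_def)
  ultimately show ?thesis unfolding sepr_def sepr_list_def by (intro map_cong) (simp_all del: upt_Suc)
qed

primrec opposite :: "sepr_sym \<Rightarrow> sepr_sym" where
  "opposite Astar = Astar"
| "opposite Aplus = Aminus"
| "opposite Aminus = Aplus"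
| "opposite Nsym = Nsym"
| "opposite Sstar = Sstar"
| "opposite Splus = Sminus"
| "opposite Sminus = Splus"

fun flip_odd :: "sepr_sym list \<Rightarrow> sepr_sym list" where
  "flip_odd [] = []"
| "flip_odd [x] = [opposite x]"
| "flip_odd (x # y # xs) = opposite x # y # flip_odd xs"

lemma length_flip_odd [simp]: "length (flip_odd xs) = length xs"
  by (induction xs rule: flip_odd.induct) auto

lemma nth_flip_odd: "k < length xs \<Longrightarrow> flip_odd xs ! k = (if even k then opposite (xs ! k) else xs ! k)"
  by (induction xs arbitrary: k rule: flip_odd.induct) (auto simp: nth_Cons split: nat.splits)

lemma sepr_cond_opposite: "sepr_cond M t \<Longrightarrow> sepr_cond (uminus ` M) (opposite t)"
  by (cases t) auto

text \<open>
  A minor of order \<open>k\<close> is multiplied by \<open>(- 1)^k\<close>; list position \<open>k\<close> belongs to order \<open>k + 1\<close>.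
\<close>

lemma sepr_uminus:
  assumes B: "B \<in> carrier_mat n n"
  shows "sepr (- B) = flip_odd (sepr B)"
proof -
  have mB: "- B \<in> carrier_mat n n" using B by simp
  have pm: "principal_minors (- B) k = (if odd k then uminus ` principal_minors B k else principal_minors B k)" for k
  proof -
    have "Re (pdet (\<lambda>i j. (- B) $$ (i, j)) T) =
        (if odd k then - Re (pdet (\<lambda>i j. B $$ (i, j)) T) else Re (pdet (\<lambda>i j. B $$ (i, j)) T))"
      if T: "T \<subseteq> {..<n}" "card T = k" for T
    proof -
      have "pdet (\<lambda>i j. (- B) $$ (i, j)) T = pdet (\<lambda>i j. - (B $$ (i, j))) T"
      proof (rule pdet_cong)
        fix i j assume "i \<in> T" "j \<in> T"
        then have "i < n" "j < n" using T(1) by auto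
        then show "(- B) $$ (i, j) = - (B $$ (i, j))" using B by simp
      qed
      also have "\<dots> = (- 1) ^ k * pdet (\<lambda>i j. B $$ (i, j)) T"
        using T pdet_uminus[of T] finite_subset[OF T(1)] by simp
      finally show ?thesis by simp
    qed
    then have "principal_minors (- B) k = (\<lambda>x. if odd k then - x else x) ` principal_minors B k"
      unfolding principal_minors_eq[OF B] principal_minors_eq[OF mB] image_image
      by (intro image_cong refl) auto
    then show ?thesis by simp
  qed
  have flip: "sepr_term (- B) k = (if odd k then opposite (sepr_term B k) else sepr_term B k)" if k: "k \<le> n" for k
  proof -
    have "sepr_cond (principal_minors B k) (sepr_term B k)"
      using k B by (intro sepr_term_cond) simp
    then have cond: "sepr_cond (principal_minors (- B) k) (if odd k then opposite (sepr_term B k) else sepr_term B k)"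
      unfolding pm by (simp add: sepr_cond_opposite)
    have uniq: "\<exists>!t. sepr_cond (principal_minors (- B) k) t"
      using k mB by (intro sepr_term_unique) auto
    show ?thesis unfolding sepr_term_def[of "- B"] by (rule the1_equality[OF uniq cond])
  qed
  have len: "length (sepr C) = dim_row C" for C by (simp add: sepr_def)
  have nth: "sepr C ! k = sepr_term C (Suc k)" if "k < dim_row C" for C k
    using that by (simp add: sepr_def del: upt_Suc)
  have dims: "dim_row B = n" "dim_row (- B) = n" using B by auto
  show ?thesis
  proof (rule nth_equalityI)
    show "length (sepr (- B)) = length (flip_odd (sepr B))" by (simp only: length_flip_odd len dims)
    fix k assume "k < length (sepr (- B))"
    then have k: "k < n" by (simp only: len dims)
    then have "sepr (- B) ! k = (if odd (Suc k) then opposite (sepr B ! k) else sepr B ! k)"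
      using flip[of "Suc k"] by (simp only: nth dims Suc_leI)
    moreover have "flip_odd (sepr B) ! k = (if even k then opposite (sepr B ! k) else sepr B ! k)"
      by (rule nth_flip_odd) (simp only: len dims k)
    ultimately show "sepr (- B) ! k = flip_odd (sepr B) ! k" by simp
  qed
qed

lemma hermitian_mat_uminus:
  assumes "hermitian_mat B" "B \<in> carrier_mat n n"
  shows "hermitian_mat (- B)"
proof (rule hermitian_matI[of _ n])
  fix i j assume ij: "i < n" "j < n"
  then have "B $$ (i, j) = cnj (B $$ (j, i))" using assms(2) by (intro hermitian_mat_index[OF assms(1)]) auto
  then show "(- B) $$ (i, j) = cnj ((- B) $$ (j, i))" using ij assms(2) by simp
qed (use assms(2) in simp)

section \<open>Every other triple occurs\<close>

text \<open>
  Each entry is a matrix, given by the two upper triangles, together with its sequence.  The matrices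
  were found by a search over small entries, followed by a choice of few matrices whose sequences and
  sign flips contain all the triples that are not excluded.  For \<open>N A\<^sup>+ S\<^sup>+\<close>, for instance, in orders three to
  five (and up to a sign flip), the graph of the nonzero entries is a triangular prism, whose triangles have purely imaginary
  cycle products and therefore zero minors of order three.
\<close>

definition witnesses :: "(int list list \<times> int list list \<times> sepr_sym list) list" where
  "witnesses = [
  ([[0, 0, -1], [0, -1], [0]], [[1, 0], [0]],
   [Nsym, Aminus, Nsym]),
  ([[-1, 2, 2, 3], [-2, -2, -2], [-1, -2], [-1]], [],
   [Aminus, Aminus, Sminus, Nsym]),
  ([[-1, 2, 3, 2], [-1, 3, 2], [-1, -2], [-2]], [],
   [Aminus, Aminus, Splus, Aplus]),
  ([[1, 2, -2, 3], [1, 2, 2], [2, -2], [1]], [],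
   [Aplus, Aminus, Sstar, Aplus]),
  ([[2, 0, -1, 2], [2, -1, -2], [1, 0], [3]], [],
   [Aplus, Aplus, Sminus, Nsym]),
  ([[-3, -1, -1, 1], [0, 2, 1], [0, 1], [0]], [],
   [Sminus, Aminus, Aplus, Nsym]),
  ([[-1, 1, 1, 1], [0, -1, 1], [0, 1], [0]], [],
   [Sminus, Aminus, Astar, Aplus]),
  ([[0, 1, 1, -1], [2, -1, 1], [0, -1], [0]], [],
   [Splus, Aminus, Sstar, Aplus]),
  ([[0, 0, 1, 1], [0, 0, -1], [0, 1], [0]], [[1, 0, 0], [-1, 0], [0]],
   [Nsym, Aminus, Splus, Aplus]),
  ([[0, 0, 1, 0], [0, -1, 1], [0, 1], [0]], [[1, 0, 1], [0, 0], [0]],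
   [Nsym, Aminus, Sstar, Aplus]),
  ([[-1, 1, -1, 0, 0], [-3, 0, 0, -1], [-2, 1, 0], [-2, -1], [-1]], [],
   [Aminus, Aplus, Aminus, Nsym, Nsym]),
  ([[-1, 1, 1, 1, -1], [-1, -1, 1, 1], [-1, -1, -1], [-1, -1], [-1]], [],
   [Aminus, Nsym, Splus, Nsym, Aminus]),
  ([[1, 0, -2, 0, -2], [1, 0, 2, -2], [1, -2, 0], [1, 0], [1]], [],
   [Aplus, Astar, Aminus, Aplus, Aplus]),
  ([[1, 2, 0, -2, 0], [1, 0, 0, 2], [1, 2, -3], [1, 0], [1]], [],
   [Aplus, Astar, Aminus, Splus, Aplus]),
  ([[1, 3, 0, 0, -2], [1, 0, 3, 1], [2, -2, -2], [1, 0], [3]], [],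
   [Aplus, Astar, Sminus, Aminus, Nsym]),
  ([[1, 2, 1, -2, -1], [1, -1, -1, 1], [1, -1, 1], [1, 1], [1]], [],
   [Aplus, Sminus, Sminus, Astar, Aplus]),
  ([[1, 1, 0, 0, 1], [1, -1, 0, -1], [1, 1, 0], [1, -1], [1]], [],
   [Aplus, Splus, Sminus, Astar, Aplus]),
  ([[2, 0, 2, 2, -2], [1, 2, -2, 0], [1, 0, 0], [2, -2], [1]], [],
   [Aplus, Sstar, Sminus, Aplus, Nsym]),
  ([[-1, 0, 0, 0, 0], [-1, 0, 0, 0], [1, 2, 2], [1, 2], [1]], [],
   [Astar, Astar, Aplus, Aminus, Aplus]),
  ([[-2, 0, 0, 0, 2], [-2, 0, 0, 2], [1, -2, 0], [1, 0], [-3]], [],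
   [Astar, Astar, Aplus, Astar, Aminus]),
  ([[1, 0, -3, 0, 0], [-1, -2, 1, 0], [1, 0, 0], [-2, 2], [-3]], [],
   [Astar, Astar, Aplus, Sstar, Aminus]),
  ([[1, -1, -2, 0, 0], [-1, 0, 2, 0], [-1, 0, 2], [-2, 0], [-1]], [],
   [Astar, Astar, Splus, Sstar, Aminus]),
  ([[0, -1, 1, -1, -1], [0, 1, -1, -3], [0, 2, 1], [0, -1], [0]], [],
   [Nsym, Aminus, Aminus, Astar, Aplus]),
  ([[0, 0, 0, 1, 1], [0, 1, 0, -1], [0, -1, 0], [0, 0], [0]], [],
   [Nsym, Sminus, Nsym, Aplus, Aplus]),
  ([[0, -1, 1, -1, 1], [0, 1, -1, 2], [-1, 1, -1], [0, 1], [0]], [],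
   [Sminus, Aminus, Sminus, Sminus, Nsym]),
  ([[0, 1, -1, -1, -1], [0, 1, -1, -2], [-2, -1, 1], [0, 2], [0]], [],
   [Sminus, Aminus, Splus, Sstar, Aminus]),
  ([[3, 2, 2, 0, 1], [3, 0, 2, -2], [1, 0, 1], [1, 1], [0]], [],
   [Splus, Astar, Sminus, Astar, Aplus]),
  ([[1, 0, 0, 0, 1], [0, -3, -2, -3], [0, -1, -1], [0, -3], [0]], [],
   [Splus, Sminus, Aminus, Aminus, Aplus]),
  ([[1, -1, -1, 0, 2], [0, 2, 1, -1], [0, 1, -1], [-1, 0], [1]], [],
   [Sstar, Aminus, Splus, Aplus, Aminus]),
  ([[0, 0, 2, 1, 2], [2, 0, -1, 0], [2, 0, 0], [0, -2], [-1]], [],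
   [Sstar, Sstar, Aminus, Sstar, Aplus]),
  ([[-1, 0, -1, 0, 0], [-2, 0, -2, 0], [0, 1, -2], [0, -2], [1]], [],
   [Sstar, Sstar, Aplus, Astar, Aminus]),
  ([[1, 1, 1, 0, 0], [1, 0, 1, -1], [1, 1, 1], [1, 0], [1]], [[0, 0, -1, 1], [1, 0, 0], [0, 0], [-1]],
   [Aplus, Nsym, Aminus, Astar, Aplus]),
  ([[0, 0, -1, -1, 0], [0, 1, 0, 0], [0, 0, 0], [0, -1], [0]], [[0, 0, 0, 0], [0, 0, 1], [0, 0], [0]],
   [Nsym, Sminus, Nsym, Aplus, Nsym]),
  ([[-1, 0, 0, 0, 0, 0], [-1, 0, 0, 0, 0], [-1, 0, 0, 0], [-2, -1, 1], [-1, 0], [-1]], [],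
   [Aminus, Aplus, Sminus, Splus, Sminus, Nsym]),
  ([[-2, 0, 0, 1, 0, 0], [-2, 0, 1, 0, 0], [-2, 1, 0, 0], [-2, 2, 1], [-2, 0], [-2]], [],
   [Aminus, Splus, Astar, Astar, Sstar, Aminus]),
  ([[1, 0, 0, 0, 0, 0], [1, 0, 0, 0, 0], [2, 0, 1, 1], [3, 2, 0], [2, 0], [1]], [],
   [Aplus, Aplus, Aplus, Astar, Astar, Aminus]),
  ([[1, 0, -1, 0, 0, 0], [1, 1, 0, 0, 0], [2, 0, 1, 0], [1, 0, 0], [1, 0], [1]], [],
   [Aplus, Aplus, Splus, Sstar, Sstar, Aminus]),
  ([[2, 1, 0, 2, 0, 0], [1, 0, 0, 0, 0], [1, 0, 0, 0], [3, 1, 0], [1, 0], [1]], [],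
   [Aplus, Aplus, Sstar, Sstar, Sstar, Aminus]),
  ([[2, 1, -2, 0, 0, -1], [1, 0, 0, 0, 0], [3, 0, 0, 0], [3, 0, 2], [3, 0], [1]], [],
   [Aplus, Astar, Sstar, Sstar, Aminus, Aminus]),
  ([[2, 0, 1, 0, 0, 0], [2, 2, 2, 0, 0], [2, 0, -1, 1], [1, 0, 0], [1, 0], [2]], [],
   [Aplus, Sstar, Astar, Sstar, Sminus, Aminus]),
  ([[2, 0, 0, 0, 0, 0], [3, 0, 2, -3, 1], [1, 0, -3, 0], [1, 0, 0], [3, 0], [2]], [],
   [Aplus, Sstar, Sstar, Astar, Sminus, Nsym]),
  ([[1, -1, 0, -1, -1, 0], [1, 0, -1, -1, 0], [-1, 0, 0, 2], [1, -1, 0], [1, 0], [-1]], [],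
   [Astar, Sminus, Sminus, Sstar, Aplus, Aplus]),
  ([[-1, 1, 0, 0, 0, 0], [1, 0, -1, -1, 3], [2, 0, -1, 0], [-3, 0, 3], [1, -1], [-1]], [],
   [Astar, Sstar, Astar, Splus, Splus, Nsym]),
  ([[0, 0, 1, 0, 0, -1], [0, 0, 0, 0, 0], [0, 0, -1, 0], [0, -1, 1], [0, 0], [0]], [],
   [Nsym, Sminus, Nsym, Splus, Sminus, Nsym]),
  ([[0, 0, 0, -1, 0, 1], [0, 1, 0, -1, 1], [0, 1, 0, 0], [0, 1, 0], [0, 0], [0]], [],
   [Nsym, Sminus, Nsym, Splus, Sstar, Aminus]),
  ([[0, 1, 1, 2, 0, 0], [0, 2, 0, 1, 0], [0, 0, 0, 1], [0, 1, 1], [0, 1], [0]], [],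
   [Nsym, Sminus, Splus, Aplus, Astar, Aminus]),
  ([[0, 0, -1, 2, 0, -1], [0, 1, -1, -1, 0], [0, -1, 0, 1], [0, 2, 0], [0, 2], [0]], [],
   [Nsym, Sminus, Splus, Aplus, Sminus, Aminus]),
  ([[0, 1, 0, 0, 2, 1], [0, -1, 2, 0, 0], [0, -1, 1, 0], [0, -1, -2], [0, 1], [0]], [],
   [Nsym, Sminus, Splus, Aplus, Sstar, Aminus]),
  ([[0, 0, -2, 1, -1, 0], [0, 0, 2, -1, -1], [0, 0, -1, 1], [0, 1, 0], [0, 1], [0]], [],
   [Nsym, Sminus, Sstar, Aplus, Splus, Aminus]),
  ([[0, 0, 0, 0, 0, 0], [-1, 0, 1, 1, 0], [0, 0, 0, 0], [-1, 1, 0], [-1, 0], [0]], [],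
   [Sminus, Nsym, Splus, Nsym, Nsym, Nsym]),
  ([[-1, 1, 0, 0, 0, -1], [0, 1, 0, 0, 0], [0, 0, 1, 0], [0, -1, -1], [-1, 0], [0]], [],
   [Sminus, Sstar, Splus, Splus, Aminus, Aplus]),
  ([[0, 0, 0, -1, 0, 1], [0, 0, 0, -1, -1], [-1, -1, 0, 0], [0, 0, 0], [-1, 0], [0]], [],
   [Sminus, Sstar, Splus, Sstar, Aminus, Nsym]),
  ([[1, 0, 0, 0, 0, -1], [1, 0, -2, 0, -1], [1, 0, 0, -1], [1, 0, -1], [1, -1], [0]], [],
   [Splus, Astar, Astar, Astar, Sminus, Aplus]),
  ([[0, 0, -3, -3, 3, 0], [0, 0, -3, 2, 2], [0, -3, 0, 3], [0, 0, 0], [1, -1], [0]], [],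
   [Splus, Sminus, Sminus, Aplus, Sminus, Nsym]),
  ([[1, 0, 1, 0, 1, 0], [1, -1, 0, 0, -1], [1, 0, 0, 1], [0, 0, 0], [1, -1], [1]], [],
   [Splus, Splus, Sminus, Sstar, Splus, Nsym]),
  ([[1, -2, -2, 0, 0, 0], [0, 0, 2, 1, 1], [2, 0, 0, 0], [2, 0, 0], [1, 0], [1]], [],
   [Splus, Sstar, Astar, Astar, Aminus, Nsym]),
  ([[2, -1, 0, 0, 0, 2], [0, -1, 0, 0, 2], [0, -1, 0, 2], [1, 2, 0], [1, 0], [0]], [],
   [Splus, Sstar, Sminus, Astar, Sstar, Aplus]),
  ([[-2, 0, 0, -1, 0, 0], [1, 2, 1, 0, 2], [1, 1, 0, 2], [0, -1, 1], [-2, 0], [1]], [],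
   [Sstar, Astar, Aplus, Sminus, Astar, Aplus]),
  ([[-1, 0, 0, 0, 0, 0], [-1, 0, 0, 0, 0], [0, -1, -1, 0], [1, 1, 0], [0, 0], [0]], [],
   [Sstar, Sstar, Splus, Sminus, Splus, Nsym]),
  ([[0, 1, 0, 1, 0, 0], [0, 1, 0, 1, 0], [0, 0, 0, 0], [0, 1, 1], [0, 0], [0]], [[0, 1, -1, 0, 0], [0, 0, -1, 0], [0, 0, 1], [0, 0], [1]],
   [Nsym, Sminus, Nsym, Aplus, Sminus, Aminus]),
  ([[0, 0, 0, 1, 0, 0], [0, 0, 0, 0, 0], [0, 0, 0, 0], [0, 1, 0], [0, 1], [0]], [[1, 1, 0, 0, 0], [1, 0, 1, 0], [0, 0, 1], [0, 1], [0]],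
   [Nsym, Sminus, Nsym, Aplus, Sstar, Aminus])]"

lemma sepr_list_witnesses: "list_all (\<lambda>(R, I, ts). sepr_list R I = ts) witnesses"
  by code_simp

fun triples :: "'a list \<Rightarrow> 'a list list" where
  "triples (x # y # z # xs) = [x, y, z] # triples (y # z # xs)"
| "triples xs = []"

lemma triples_sublist: "\<sigma> \<in> set (triples xs) \<Longrightarrow> sublist \<sigma> xs"
  by (induction xs rule: triples.induct) (auto simp: sublist_Cons_right)

lemma length_triples: "\<sigma> \<in> set (triples xs) \<Longrightarrow> length \<sigma> = 3"
  by (induction xs rule: triples.induct) auto

text \<open>
  The triples are grouped by their first symbol, as the pairs that follow it, which keeps the lists in the
  evaluation below short.
\<close>

definition attained_after :: "sepr_sym \<Rightarrow> sepr_sym list list" where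
  "attained_after t = concat (map (\<lambda>(R, I, ts).
     map tl (filter (\<lambda>\<tau>. hd \<tau> = t) (triples ts @ triples (flip_odd ts)))) witnesses)"

text \<open>
  The candidate list is divided by the next symbol at each step because rewriting traverses a list anew
  whenever an element has been processed, which makes long lists costly.
\<close>

primrec covered :: "nat \<Rightarrow> sepr_sym list \<Rightarrow> sepr_sym list list \<Rightarrow> bool" where
  "covered 0 \<pi> T \<longleftrightarrow> T \<noteq> [] \<or> excluded \<pi>"
| "covered (Suc n) \<pi> T \<longleftrightarrow>
     list_all (\<lambda>t. covered n (\<pi> @ [t]) (map tl (filter (\<lambda>\<tau>. hd \<tau> = t) T)))
       [Astar, Aplus, Aminus, Nsym, Sstar, Splus, Sminus]"

lemma covered_imp_excluded:
  assumes "covered n \<pi> T" "length \<sigma> = n" "\<forall>\<tau>\<in>set T. length \<tau> = n" "\<sigma> \<notin> set T"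
  shows "excluded (\<pi> @ \<sigma>)"
  using assms
proof (induction n arbitrary: \<pi> T \<sigma>)
  case 0
  then show ?case by (cases T) auto
next
  case (Suc n)
  then obtain t \<sigma>' where \<sigma>: "\<sigma> = t # \<sigma>'" "length \<sigma>' = n" by (cases \<sigma>) auto
  let ?T = "map tl (filter (\<lambda>\<tau>. hd \<tau> = t) T)"
  have "covered n (\<pi> @ [t]) ?T" using Suc.prems(1) by (cases t) simp_all
  moreover have "\<forall>\<tau>\<in>set ?T. length \<tau> = n" using Suc.prems(3) by auto
  moreover have "\<sigma>' \<notin> set ?T"
  proof
    assume "\<sigma>' \<in> set ?T"
    then obtain \<tau> where \<tau>: "\<tau> \<in> set T" "hd \<tau> = t" "\<sigma>' = tl \<tau>" by auto
    moreover from this have "\<tau> \<noteq> []" using Suc.prems(3) by fastforce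
    ultimately have "\<sigma> = \<tau>" using \<sigma>(1) by (cases \<tau>) auto
    with \<tau>(1) Suc.prems(4) show False by blast
  qed
  ultimately have "excluded ((\<pi> @ [t]) @ \<sigma>')" using Suc.IH \<sigma>(2) by blast
  then show ?case using \<sigma>(1) by simp
qed

lemma attained_after_covers:
  "list_all (\<lambda>t. covered 2 [t] (attained_after t))
     [Astar, Aplus, Aminus, Nsym, Sstar, Splus, Sminus]"
  by code_simp

lemma attained_triple_occurs:
  assumes "\<sigma> \<in> set (attained_after t)"
  shows "\<exists>n B. n \<ge> 1 \<and> B \<in> carrier_mat n n \<and> hermitian_mat B \<and> sublist (t # \<sigma>) (sepr B)"
proof -
  obtain R I ts \<tau> where w: "(R, I, ts) \<in> set witnesses"
    and \<tau>: "\<tau> \<in> set (triples ts) \<or> \<tau> \<in> set (triples (flip_odd ts))" "hd \<tau> = t" "\<sigma> = tl \<tau>"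
    using assms unfolding attained_after_def by auto
  have "length \<tau> = 3" using \<tau>(1) length_triples by blast
  then have \<tau>_eq: "\<tau> = t # \<sigma>" using \<tau>(2,3) by (cases \<tau>) auto
  let ?B = "witness_mat R I"
  have B: "?B \<in> carrier_mat (length R) (length R)" by (rule witness_mat_carrier)
  have ts: "sepr ?B = ts"
    using sepr_list_witnesses w by (auto simp: list_all_iff sepr_witness_mat)
  have "sublist \<tau> (sepr ?B) \<or> sublist \<tau> (sepr (- ?B))"
    using \<tau>(1) triples_sublist unfolding sepr_uminus[OF B] ts by blast
  then obtain C where C: "C \<in> carrier_mat (length R) (length R)" "hermitian_mat C" "sublist (t # \<sigma>) (sepr C)"
    using B witness_mat_hermitian[of R I] hermitian_mat_uminus[OF witness_mat_hermitian B]
    unfolding \<tau>_eq by (metis uminus_carrier_mat)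
  have "length (t # \<sigma>) \<le> length (sepr C)" using C(3) by (rule sublist_length_le)
  then have "length R \<ge> 1" using C(1) by (simp add: sepr_def del: upt_Suc)
  with C show ?thesis by blast
qed

theorem theorem4p5:
  fixes \<sigma> :: "sepr_sym list"
  assumes "length \<sigma> = 3"
  shows
    "(\<not> (\<exists>(n::nat) B. n \<ge> 1 \<and> B \<in> carrier_mat n n \<and> hermitian_mat B \<and> sublist \<sigma> (sepr B)))
     \<longleftrightarrow>
     (\<exists>X \<in> {Astar, Nsym, Sstar, Splus, Sminus}.
        \<sigma> \<in> {[Aplus, X, Aplus], [Aminus, X, Aminus], [Splus, X, Aplus], [Sminus, X, Aminus]})
     \<or> (\<exists>Y \<in> {Astar, Nsym, Sstar}.
        \<sigma> \<in> {[Aplus, Y, Splus], [Aminus, Y, Sminus], [Splus, Y, Splus], [Sminus, Y, Sminus]})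
     \<or> (sublist [Astar, Nsym] \<sigma> \<or> sublist [Nsym, Astar] \<sigma>
        \<or> sublist [Sstar, Nsym] \<sigma> \<or> sublist [Nsym, Sstar] \<sigma>)
     \<or> uepr \<sigma> \<in> {[UeprN, UeprN, UeprA], [UeprN, UeprN, UeprS], [UeprN, UeprS, UeprA]}"
  unfolding excluded_def[symmetric]
proof
  assume not_attained: "\<not> (\<exists>(n::nat) B. n \<ge> 1 \<and> B \<in> carrier_mat n n \<and> hermitian_mat B \<and> sublist \<sigma> (sepr B))"
  obtain t \<sigma>' where \<sigma>: "\<sigma> = t # \<sigma>'" "length \<sigma>' = 2"
    using assms by (cases \<sigma>) auto
  have "\<sigma>' \<notin> set (attained_after t)"
    using attained_triple_occurs not_attained unfolding \<sigma>(1) by blast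
  moreover have "\<forall>\<tau>\<in>set (attained_after t). length \<tau> = 2"
    by (auto simp: attained_after_def dest: length_triples)
  moreover have "covered 2 [t] (attained_after t)"
    using attained_after_covers by (cases t) simp_all
  ultimately have "excluded ([t] @ \<sigma>')" using \<sigma>(2) by (intro covered_imp_excluded)
  then show "excluded \<sigma>" using \<sigma>(1) by simp
next
  assume "excluded \<sigma>"
  moreover obtain a b c where "\<sigma> = [a, b, c]"
    using assms by (auto simp: length_Suc_conv numeral_3_eq_3)
  ultimately show "\<not> (\<exists>(n::nat) B. n \<ge> 1 \<and> B \<in> carrier_mat n n \<and> hermitian_mat B \<and> sublist \<sigma> (sepr B))"
    using excluded_not_attained by blast
qed

end
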